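(* Let $F=\frac1n\sum_{i=1}^nf_i$, where each $f_i$ is possibly non-convex but $L$-smooth. Run the NCGS-VR algorithm (defined in the context) with $b=n^{2/3}$, $m=n^{1/3}$, $\lambda_t=\lambda=\frac{1}{3L}$, $T$ a multiple of $m$, and $\eta_t=\eta=\frac1T$. Then the IFO and LO complexities of the algorithm for achieving $\mathbb{E}[\|g(\theta_\alpha,\nabla F(\theta_\alpha),\lambda)\|^2]\le\epsilon$ are $\mathcal{O}\big(\frac{n^{2/3}}{\epsilon}\big)$ and $\mathcal{O}\big(\frac1{\epsilon^2}\big)$ respectively.
   Context: The problem is to minimize $F$ over the constraint set $\Omega\subset\mathbb{R}^d$. A function $f$ is $L$-smooth if $\|\nabla f(\theta_1)-\nabla f(\theta_2)\|\le L\|\theta_1-\theta_2\|$ for all $\theta_1,\theta_2\in\Omega$. Define $\psi(x,\omega,\gamma)=\arg\min_{\theta\in\Omega}\langle\omega,\theta\rangle+\frac{1}{2\gamma}\|\theta-x\|^2$, and the gradient mapping $g(x,\omega,\gamma)=\frac1\gamma\big(x-\psi(x,\omega,\gamma)\big)$. Oracles: an IFO (incremental first order oracle) call returns $\nabla f_i(\theta)$ for one index $i\in\{1,\dots,n\}$; an LO (linear oracle) call solves $\arg\min_{\theta\in\Omega}\langle\theta,w\rangle$ for a given vector $w$. The IFO (LO) complexity is the number of IFO (LO) calls needed to obtain a solution with $\epsilon$ accuracy. Procedure $u^+=condg(w,u,\lambda,\eta)$: set $u_1=u$. For $t=1,2,\dots$: let $v_t$ be an optimal solution of $V(u_t)=\max_{x\in\Omega}\langle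 w+\frac1\lambda(u_t-u),u_t-x\rangle$ (one LO call); if $V(u_t)\le\eta$, return $u^+=u_t$ and stop; otherwise set $u_{t+1}=(1-\xi_t)u_t+\xi_tv_t$ with $\xi_t=\min\Big\{1,\frac{\langle\frac1\lambda(u-u_t)-w,\,v_t-u_t\rangle}{\frac1\lambda\|v_t-u_t\|^2}\Big\}$. NCGS-VR algorithm with epoch length $m$, step sizes $\lambda_t$, tolerances $\eta_t$, minibatch size $b$, iteration limit $T$, $S=T/m$: set $\tilde\theta^0=\theta_m^0=\theta_0\in\mathbb{R}^d$. For $s=0,\dots,S-1$: set $\theta_0^{s+1}=\theta_m^s$ and $g^{s+1}=\frac1n\sum_{i=1}^n\nabla f_i(\tilde\theta^s)$; for $t=0,\dots,m-1$: pick $I_t$ uniformly from $\{1,\dots,n\}$ with replacement such that $|I_t|=b$, set $v_t^{s+1}=\frac1b\sum_{i\in I_t}\big(\nabla f_i(\theta_t^{s+1})-\nabla f_i(\tilde\theta^s)\big)+g^{s+1}$ and $\theta_{t+1}^{s+1}=condg(v_t^{s+1},\theta_t^{s+1},\lambda_t,\eta_t)$; then set $\tilde\theta^{s+1}=\theta_m^{s+1}$. Output $\theta_\alpha$ chosen uniformly at random from $\{\theta_t^{s+1}:0\le t\le m-1,\ 0\le s\le S-1\}$. The expectation is over the random index draws and the random choice of output.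
   Formalization: Ω is assumed compact and convex with θ₀ in Ω; n^{1/3}, n^{2/3} are rounded to integers; the IFO and LO bounds are claimed for n^{1/3}ε ≤ K (K any fixed constant, hidden constant may depend on K), since one epoch alone already costs n IFO calls. *)

theory Defs
  imports "HOL-Probability.Probability"
begin

definition gradient :: "('a::euclidean_space \<Rightarrow> real) \<Rightarrow> 'a \<Rightarrow> 'a" where
  "gradient f x = (THE D. GDERIV f x :> D)"

definition L_smooth_on :: "'a::euclidean_space set \<Rightarrow> real \<Rightarrow> ('a \<Rightarrow> real) \<Rightarrow> bool" where
  "L_smooth_on \<Omega> L f \<longleftrightarrow>
     (\<forall>x\<in>\<Omega>. f differentiable (at x)) \<and>
     (\<forall>x\<in>\<Omega>. \<forall>y\<in>\<Omega>. norm (gradient f x - gradient f y) \<le> L * norm (x - y))"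

definition avg :: "(nat \<Rightarrow> 'a::euclidean_space \<Rightarrow> real) \<Rightarrow> nat \<Rightarrow> 'a \<Rightarrow> real" where
  "avg f n x = (1 / real n) * (\<Sum>i=1..n. f i x)"

definition prox_step :: "'a::euclidean_space set \<Rightarrow> 'a \<Rightarrow> 'a \<Rightarrow> real \<Rightarrow> 'a" where
  "prox_step \<Omega> x \<omega> \<gamma> =
     arg_min_on (\<lambda>\<theta>. \<omega> \<bullet> \<theta> + 1 / (2 * \<gamma>) * (norm (\<theta> - x))\<^sup>2) \<Omega>"

definition grad_mapping :: "'a::euclidean_space set \<Rightarrow> 'a \<Rightarrow> 'a \<Rightarrow> real \<Rightarrow> 'a" where
  "grad_mapping \<Omega> x \<omega> \<gamma> = (1 / \<gamma>) *\<^sub>R (x - prox_step \<Omega> x \<omega> \<gamma>)"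

(* The linear oracle may return any minimizer; results about the algorithm are to be
   stated for every such selection. *)
definition linear_oracle :: "'a::euclidean_space set \<Rightarrow> ('a \<Rightarrow> 'a) \<Rightarrow> bool" where
  "linear_oracle \<Omega> lo \<longleftrightarrow> (\<forall>w. is_arg_min (\<lambda>\<theta>. \<theta> \<bullet> w) (\<lambda>\<theta>. \<theta> \<in> \<Omega>) (lo w))"

definition condg_gap :: "'a::euclidean_space set \<Rightarrow> 'a \<Rightarrow> 'a \<Rightarrow> real \<Rightarrow> 'a \<Rightarrow> real" where
  "condg_gap \<Omega> w u lam z = (SUP x\<in>\<Omega>. (w + (1 / lam) *\<^sub>R (z - u)) \<bullet> (z - x))"

definition condg_step :: "('a::euclidean_space \<Rightarrow> 'a) \<Rightarrow> 'a \<Rightarrow> 'a \<Rightarrow> real \<Rightarrow> 'a \<Rightarrow> 'a" where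
  "condg_step lo w u lam z =
     (let v = lo (w + (1 / lam) *\<^sub>R (z - u));
          \<xi> = min 1 ((((1 / lam) *\<^sub>R (u - z) - w) \<bullet> (v - z)) / ((1 / lam) * (norm (v - z))\<^sup>2))
      in (1 - \<xi>) *\<^sub>R z + \<xi> *\<^sub>R v)"

(* Zero-based: the k-th iterate below is the point called u_(k+1) in the usual description. *)
definition condg_iterate :: "('a::euclidean_space \<Rightarrow> 'a) \<Rightarrow> 'a \<Rightarrow> 'a \<Rightarrow> real \<Rightarrow> nat \<Rightarrow> 'a" where
  "condg_iterate lo w u lam k = (condg_step lo w u lam ^^ k) u"

definition condg_stops ::
  "'a::euclidean_space set \<Rightarrow> ('a \<Rightarrow> 'a) \<Rightarrow> 'a \<Rightarrow> 'a \<Rightarrow> real \<Rightarrow> real \<Rightarrow> nat \<Rightarrow> bool" where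
  "condg_stops \<Omega> lo w u lam \<eta> k \<longleftrightarrow> condg_gap \<Omega> w u lam (condg_iterate lo w u lam k) \<le> \<eta>"

definition condg ::
  "'a::euclidean_space set \<Rightarrow> ('a \<Rightarrow> 'a) \<Rightarrow> 'a \<Rightarrow> 'a \<Rightarrow> real \<Rightarrow> real \<Rightarrow> 'a" where
  "condg \<Omega> lo w u lam \<eta> = condg_iterate lo w u lam (LEAST k. condg_stops \<Omega> lo w u lam \<eta> k)"

(* Number of linear-oracle calls: one for every iterate whose gap is tested, including the
   one that is returned; infinite if the loop does not terminate. *)
definition condg_lo_calls ::
  "'a::euclidean_space set \<Rightarrow> ('a \<Rightarrow> 'a) \<Rightarrow> 'a \<Rightarrow> 'a \<Rightarrow> real \<Rightarrow> real \<Rightarrow> enat" where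
  "condg_lo_calls \<Omega> lo w u lam \<eta> =
     (if \<exists>k. condg_stops \<Omega> lo w u lam \<eta> k
      then enat (Suc (LEAST k. condg_stops \<Omega> lo w u lam \<eta> k)) else \<infinity>)"

(* Current iterate; points at which an inner step was started, in chronological order
   (the candidates for the output); IFO calls so far; LO calls so far. *)
type_synonym 'a run_state = "'a \<times> 'a list \<times> nat \<times> enat"

(* Each sampled index costs two IFO calls, one at the current iterate and one at the
   snapshot. *)
definition vr_step ::
  "'a::euclidean_space set \<Rightarrow> ('a \<Rightarrow> 'a) \<Rightarrow> (nat \<Rightarrow> 'a \<Rightarrow> real) \<Rightarrow> nat \<Rightarrow> real \<Rightarrow> real \<Rightarrow>
   'a \<Rightarrow> 'a \<Rightarrow> nat list \<Rightarrow> 'a run_state \<Rightarrow> 'a run_state" where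
  "vr_step \<Omega> lo f b lam \<eta> snapshot g I st =
     (let (\<theta>, visited, ifo_calls, lo_calls) = st;
          v = (1 / real b) *\<^sub>R
                (\<Sum>i\<leftarrow>I. gradient (f i) \<theta> - gradient (f i) snapshot) + g
      in (condg \<Omega> lo v \<theta> lam \<eta>, visited @ [\<theta>], ifo_calls + 2 * b,
          lo_calls + condg_lo_calls \<Omega> lo v \<theta> lam \<eta>))"

primrec vr_inner ::
  "'a::euclidean_space set \<Rightarrow> ('a \<Rightarrow> 'a) \<Rightarrow> (nat \<Rightarrow> 'a \<Rightarrow> real) \<Rightarrow> nat \<Rightarrow> nat \<Rightarrow>
   (nat \<Rightarrow> real) \<Rightarrow> (nat \<Rightarrow> real) \<Rightarrow> 'a \<Rightarrow> 'a \<Rightarrow> nat \<Rightarrow> 'a run_state \<Rightarrow> 'a run_state pmf" where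
  "vr_inner \<Omega> lo f n b lam \<eta> snapshot g 0 st = return_pmf st"
| "vr_inner \<Omega> lo f n b lam \<eta> snapshot g (Suc t) st =
     do { st' \<leftarrow> vr_inner \<Omega> lo f n b lam \<eta> snapshot g t st;
          I \<leftarrow> replicate_pmf b (pmf_of_set {1..n});
          return_pmf (vr_step \<Omega> lo f b (lam t) (\<eta> t) snapshot g I st') }"

definition vr_epoch ::
  "'a::euclidean_space set \<Rightarrow> ('a \<Rightarrow> 'a) \<Rightarrow> (nat \<Rightarrow> 'a \<Rightarrow> real) \<Rightarrow> nat \<Rightarrow> nat \<Rightarrow> nat \<Rightarrow>
   (nat \<Rightarrow> real) \<Rightarrow> (nat \<Rightarrow> real) \<Rightarrow> 'a run_state \<Rightarrow> 'a run_state pmf" where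
  "vr_epoch \<Omega> lo f n m b lam \<eta> st =
     (let (snapshot, visited, ifo_calls, lo_calls) = st;
          g = (1 / real n) *\<^sub>R (\<Sum>i=1..n. gradient (f i) snapshot)
      in vr_inner \<Omega> lo f n b lam \<eta> snapshot g m (snapshot, visited, ifo_calls + n, lo_calls))"

primrec vr_epochs ::
  "'a::euclidean_space set \<Rightarrow> ('a \<Rightarrow> 'a) \<Rightarrow> (nat \<Rightarrow> 'a \<Rightarrow> real) \<Rightarrow> nat \<Rightarrow> nat \<Rightarrow> nat \<Rightarrow>
   (nat \<Rightarrow> real) \<Rightarrow> (nat \<Rightarrow> real) \<Rightarrow> 'a \<Rightarrow> nat \<Rightarrow> 'a run_state pmf" where
  "vr_epochs \<Omega> lo f n m b lam \<eta> \<theta>\<^sub>0 0 = return_pmf (\<theta>\<^sub>0, [], 0, 0)"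
| "vr_epochs \<Omega> lo f n m b lam \<eta> \<theta>\<^sub>0 (Suc s) =
     do { st \<leftarrow> vr_epochs \<Omega> lo f n m b lam \<eta> \<theta>\<^sub>0 s;
          vr_epoch \<Omega> lo f n m b lam \<eta> st }"

(* Joint distribution of the output, the number of IFO calls and the number of LO calls.
   The output is drawn uniformly over the time indices, so repeated points keep their
   multiplicity. *)
definition ncgs_vr ::
  "'a::euclidean_space set \<Rightarrow> ('a \<Rightarrow> 'a) \<Rightarrow> (nat \<Rightarrow> 'a \<Rightarrow> real) \<Rightarrow> nat \<Rightarrow> nat \<Rightarrow> nat \<Rightarrow>
   (nat \<Rightarrow> real) \<Rightarrow> (nat \<Rightarrow> real) \<Rightarrow> nat \<Rightarrow> 'a \<Rightarrow> ('a \<times> nat \<times> enat) pmf" where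
  "ncgs_vr \<Omega> lo f n m b lam \<eta> T \<theta>\<^sub>0 =
     do { (\<theta>, visited, ifo_calls, lo_calls) \<leftarrow> vr_epochs \<Omega> lo f n m b lam \<eta> \<theta>\<^sub>0 (T div m);
          \<alpha> \<leftarrow> pmf_of_set {..<length visited};
          return_pmf (visited ! \<alpha>, ifo_calls, lo_calls) }"

(* These are n^(1/3) and n^(2/3) exactly when n is a cube; the rounding extends the choice
   to every n and keeps m^2 \<le> b. *)
definition epoch_length :: "nat \<Rightarrow> nat" where
  "epoch_length n = nat \<lfloor>real n powr (1/3)\<rfloor>"

definition batch_size :: "nat \<Rightarrow> nat" where
  "batch_size n = nat \<lceil>real n powr (2/3)\<rceil>"

end

(*
  The Frank-Wolfe inner loop has a first step that brings the primal gap of the proximal subproblem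
  below D^2/(2 lam), whatever the size of the gradient estimate w; the usual O(1/k) rate then
  bounds the number of linear-oracle calls by O(D^2/(lam eta)), uniformly in the run.

  For the outer loop, the point y returned by condg satisfies
    F y <= F x - |g|^2/(6 L) - L |y - x|^2 + |grad F x - v|^2/(6 L) + eta
  where g is the exact gradient mapping at x. The minibatch variance is at most
  L^2 |x - snapshot|^2 / b, and since m^2 <= b the terms L |y - x|^2 pay for it over an epoch.
  Telescoping over the T steps with eta = 1/T gives E|g|^2 <= 6 L (Delta + 1) / T.
*)
theory Submission
  imports Defs
begin

text \<open>\<open>condg\<close> stops on the duality gap, whereas the O(1/k) rate controls only the
  primal gap; a second stretch of iterations, as long as the first, carries the rate over to the
  smallest duality gap seen. Positions and call counts are controlled on every run in the support,
  so randomness enters only through the minibatch variance and the choice of the output. The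
  obstacle to a plain O-statement in n and \<epsilon> is rounding: a run consists of whole epochs,
  at least one, and each spends n IFO calls on the full gradient. A bound C n^(2/3)/\<epsilon>
  therefore forces n^(1/3) \<epsilon> \<le> C. This is why the call bounds are stated for n^(1/3)
  \<epsilon> \<le> K with C depending on K: there, rounding T up to a multiple of m adds at most m
  \<le> K/\<epsilon>.\<close>

section \<open>Gradients and the quadratic upper bound of a smooth function\<close>

lemma gradient_eqI:
  assumes "GDERIV f x :> D"
  shows "gradient f x = D"
  unfolding gradient_def
proof (rule the_equality)
  show "GDERIV f x :> D" by (rule assms)
  fix E assume "GDERIV f x :> E"
  with assms have "(\<lambda>h. h \<bullet> E) = (\<lambda>h. h \<bullet> D)"
    unfolding gderiv_def by (rule has_derivative_unique[rotated])
  then show "E = D"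
    using vector_eq_rdot[of E D] by (auto dest: fun_cong simp: inner_commute)
qed

text \<open>Riesz representation in coordinates: the derivative applied to the basis vectors gives
  the entries of the gradient.\<close>

lemma GDERIV_gradient:
  assumes "f differentiable (at x)"
  shows "GDERIV f x :> gradient f x"
proof -
  obtain f' where f': "(f has_derivative f') (at x)"
    using assms by (auto simp: differentiable_def)
  then interpret bounded_linear f' by (rule has_derivative_bounded_linear)
  have "f' h = h \<bullet> (\<Sum>b\<in>Basis. f' b *\<^sub>R b)" for h
  proof -
    have "f' h = f' (\<Sum>b\<in>Basis. (h \<bullet> b) *\<^sub>R b)"
      by (simp add: euclidean_representation)
    also have "\<dots> = h \<bullet> (\<Sum>b\<in>Basis. f' b *\<^sub>R b)"
      by (simp add: sum scaleR inner_sum_right mult.commute)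
    finally show ?thesis .
  qed
  then have "f' = (\<lambda>h. h \<bullet> (\<Sum>b\<in>Basis. f' b *\<^sub>R b))"
    by (rule ext)
  with f' have "GDERIV f x :> (\<Sum>b\<in>Basis. f' b *\<^sub>R b)"
    unfolding gderiv_def by metis
  then show ?thesis
    using gradient_eqI by metis
qed

lemma GDERIV_avg:
  assumes "\<And>i. i \<in> {1..n} \<Longrightarrow> f i differentiable (at x)"
  shows "GDERIV (avg f n) x :> (1 / real n) *\<^sub>R (\<Sum>i=1..n. gradient (f i) x)"
proof -
  have "((\<lambda>x. (1 / real n) * (\<Sum>i=1..n. f i x)) has_derivative
      (\<lambda>h. (1 / real n) * (\<Sum>i=1..n. h \<bullet> gradient (f i) x))) (at x)"
    using GDERIV_gradient[OF assms]
    by (intro has_derivative_mult_right has_derivative_sum) (simp add: gderiv_def)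
  then show ?thesis
    by (simp add: gderiv_def avg_def[abs_def] inner_sum_right)
qed

lemma L_smooth_on_avg:
  assumes n: "n \<ge> 1" and f: "\<And>i. i \<in> {1..n} \<Longrightarrow> L_smooth_on \<Omega> L (f i)"
  shows "L_smooth_on \<Omega> L (avg f n)"
    and "x \<in> \<Omega> \<Longrightarrow> gradient (avg f n) x = (1 / real n) *\<^sub>R (\<Sum>i=1..n. gradient (f i) x)"
proof -
  have G: "GDERIV (avg f n) x :> (1 / real n) *\<^sub>R (\<Sum>i=1..n. gradient (f i) x)" if "x \<in> \<Omega>" for x
    using f that by (intro GDERIV_avg) (auto simp: L_smooth_on_def)
  show g: "gradient (avg f n) x = (1 / real n) *\<^sub>R (\<Sum>i=1..n. gradient (f i) x)" if "x \<in> \<Omega>" for x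
    using G[OF that] by (rule gradient_eqI)
  show "L_smooth_on \<Omega> L (avg f n)"
    unfolding L_smooth_on_def
  proof safe
    fix x assume "x \<in> \<Omega>"
    then show "avg f n differentiable (at x)"
      using G by (auto simp: differentiable_def gderiv_def)
    fix y assume "y \<in> \<Omega>"
    have "norm (gradient (avg f n) x - gradient (avg f n) y)
        = (1 / real n) * norm (\<Sum>i=1..n. gradient (f i) x - gradient (f i) y)"
      using g \<open>x \<in> \<Omega>\<close> \<open>y \<in> \<Omega>\<close> by (simp add: sum_subtractf flip: scaleR_diff_right)
    also have "\<dots> \<le> (1 / real n) * (\<Sum>i=1..n. L * norm (x - y))"
      using f \<open>x \<in> \<Omega>\<close> \<open>y \<in> \<Omega>\<close>
      by (intro mult_left_mono sum_norm_le) (auto simp: L_smooth_on_def)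
    also have "\<dots> = L * norm (x - y)"
      using n by simp
    finally show "norm (gradient (avg f n) x - gradient (avg f n) y) \<le> L * norm (x - y)" .
  qed
qed

lemma L_smooth_on_quadratic_upper_bound:
  assumes f: "L_smooth_on \<Omega> L f" and "convex \<Omega>" "x \<in> \<Omega>" "y \<in> \<Omega>"
  shows "f y \<le> f x + gradient f x \<bullet> (y - x) + L / 2 * (norm (y - x))\<^sup>2"
proof -
  define d where "d = y - x"
  define p where "p t = x + t *\<^sub>R d" for t
  have p: "p t \<in> \<Omega>" if "0 \<le> t" "t \<le> 1" for t
    using convexD[OF \<open>convex \<Omega>\<close> \<open>x \<in> \<Omega>\<close> \<open>y \<in> \<Omega>\<close>, of "1 - t" t] that
    by (simp add: p_def d_def algebra_simps)
  \<comment> \<open>On the segment, \<open>h\<close> is \<open>f\<close> minus its linear part at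
    \<open>x\<close> and minus the quadratic bound, so \<open>h 1 \<le> h 0\<close> is the claim.
    Convexity keeps the segment inside \<Omega>, where the Lipschitz bound on the gradient is
    available.\<close>
  define h where "h t = f (p t) - t * (gradient f x \<bullet> d) - L / 2 * (norm d)\<^sup>2 * t\<^sup>2" for t
  have "h 1 \<le> h 0"
  proof (rule DERIV_nonpos_imp_nonincreasing[of 0 1 h])
    fix t :: real assume t: "0 \<le> t" "t \<le> 1"
    have "GDERIV f (p t) :> gradient f (p t)"
      using f p[OF t] by (intro GDERIV_gradient) (auto simp: L_smooth_on_def)
    then have "((\<lambda>t. f (p t)) has_derivative (\<lambda>e. (e *\<^sub>R d) \<bullet> gradient f (p t))) (at t)"
      unfolding gderiv_def p_def by (rule has_derivative_compose[rotated]) (auto intro!: derivative_eq_intros)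
    then have "((\<lambda>t. f (p t)) has_real_derivative gradient f (p t) \<bullet> d) (at t)"
      by (simp add: has_field_derivative_def inner_commute mult.commute[of _ "_ \<bullet> _"])
    then have "(h has_real_derivative (gradient f (p t) - gradient f x) \<bullet> d - L * (norm d)\<^sup>2 * t) (at t)"
      unfolding h_def by (auto intro!: derivative_eq_intros simp: inner_diff_left)
    moreover have "(gradient f (p t) - gradient f x) \<bullet> d \<le> L * (norm d)\<^sup>2 * t"
    proof -
      have "(gradient f (p t) - gradient f x) \<bullet> d \<le> norm (gradient f (p t) - gradient f x) * norm d"
        by (rule norm_cauchy_schwarz)
      also have "\<dots> \<le> L * norm (p t - x) * norm d"
        using f p[OF t] \<open>x \<in> \<Omega>\<close> by (intro mult_right_mono) (auto simp: L_smooth_on_def)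
      also have "\<dots> = L * (norm d)\<^sup>2 * t"
        using t by (simp add: p_def power2_eq_square)
      finally show ?thesis .
    qed
    ultimately show "\<exists>D. (h has_real_derivative D) (at t) \<and> D \<le> 0"
      by (intro exI conjI) auto
  qed simp
  then show ?thesis
    by (simp add: h_def p_def d_def)
qed

section \<open>The proximal subproblem and its minimizer\<close>

text \<open>Divide by \<open>t\<close> and let it tend to 0 from above. This turns minimality along
  a segment into a first-order condition.\<close>

lemma nonneg_of_linear_plus_quadratic:
  fixes a c :: real
  assumes "\<And>t. 0 < t \<Longrightarrow> t \<le> 1 \<Longrightarrow> 0 \<le> t * a + t\<^sup>2 * c"
  shows "0 \<le> a"
proof (rule tendsto_lowerbound)
  show "((\<lambda>t. a + t * c) \<longlongrightarrow> a) (at_right 0)"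
    by (auto intro!: tendsto_eq_intros)
  have "0 \<le> a + t * c" if "0 < t" "t < 1" for t
  proof -
    have "0 \<le> t * (a + t * c)"
      using assms[of t] that by (simp add: power2_eq_square algebra_simps)
    then show ?thesis using that by (simp add: zero_le_mult_iff)
  qed
  then show "\<forall>\<^sub>F t in at_right 0. 0 \<le> a + t * c"
    by (auto simp: eventually_at_right_field intro: exI[of _ 1])
qed simp

text \<open>The objective inside \<open>prox_step\<close>, named because \<open>condg\<close> with
  data \<open>w\<close>, \<open>u\<close>, \<open>lam\<close> is Frank-Wolfe applied to
  \<open>prox_objective u w lam\<close>.\<close>

definition prox_objective :: "'a::euclidean_space \<Rightarrow> 'a \<Rightarrow> real \<Rightarrow> 'a \<Rightarrow> real" where
  "prox_objective x \<omega> \<gamma> \<theta> = \<omega> \<bullet> \<theta> + 1 / (2 * \<gamma>) * (norm (\<theta> - x))\<^sup>2"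

text \<open>A quadratic has an exact second-order expansion. The vector in the linear term is its
  gradient at \<open>y\<close>, the one that also appears in \<open>condg_gap\<close> and in the
  oracle query.\<close>

lemma prox_objective_line:
  "prox_objective x \<omega> \<gamma> (y + t *\<^sub>R d) = prox_objective x \<omega> \<gamma> y
     + t * ((\<omega> + (1 / \<gamma>) *\<^sub>R (y - x)) \<bullet> d) + t\<^sup>2 * (1 / (2 * \<gamma>) * (norm d)\<^sup>2)"
proof -
  define e where "e = y - x"
  have "(norm (e + t *\<^sub>R d))\<^sup>2 = (norm e)\<^sup>2 + 2 * t * (e \<bullet> d) + t\<^sup>2 * (norm d)\<^sup>2"
    unfolding power2_norm_eq_inner
    by (simp add: inner_add_left inner_add_right inner_commute power2_eq_square)
  moreover have "y + t *\<^sub>R d - x = e + t *\<^sub>R d"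
    by (simp add: e_def)
  ultimately have "(norm (y + t *\<^sub>R d - x))\<^sup>2 = (norm e)\<^sup>2 + 2 * t * (e \<bullet> d) + t\<^sup>2 * (norm d)\<^sup>2"
    by (simp only:)
  then show ?thesis
    unfolding prox_objective_def e_def[symmetric]
    by (simp add: inner_add_left inner_add_right distrib_left add_divide_distrib)
qed

text \<open>Compactness yields a minimizer, so the choice hidden in \<open>arg_min_on\<close> does
  pick one. Comparing it with points slightly displaced towards \<open>z\<close> gives the
  variational inequality.\<close>

lemma prox_step:
  assumes "compact \<Omega>" "convex \<Omega>" "\<Omega> \<noteq> {}" "\<gamma> > 0"
  shows prox_step_in: "prox_step \<Omega> x \<omega> \<gamma> \<in> \<Omega>"
    and prox_step_le: "z \<in> \<Omega> \<Longrightarrow>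
      prox_objective x \<omega> \<gamma> (prox_step \<Omega> x \<omega> \<gamma>) \<le> prox_objective x \<omega> \<gamma> z"
    and prox_step_variational: "z \<in> \<Omega> \<Longrightarrow>
      (\<omega> + (1 / \<gamma>) *\<^sub>R (prox_step \<Omega> x \<omega> \<gamma> - x)) \<bullet> (prox_step \<Omega> x \<omega> \<gamma> - z) \<le> 0"
proof -
  let ?q = "prox_objective x \<omega> \<gamma>"
  define y where "y = prox_step \<Omega> x \<omega> \<gamma>"
  have "\<exists>y\<in>\<Omega>. \<forall>z\<in>\<Omega>. ?q y \<le> ?q z"
    using assms unfolding prox_objective_def by (intro continuous_attains_inf continuous_intros) auto
  then have "\<exists>y. is_arg_min ?q (\<lambda>\<theta>. \<theta> \<in> \<Omega>) y"
    by (auto simp: is_arg_min_linorder)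
  then have "is_arg_min ?q (\<lambda>\<theta>. \<theta> \<in> \<Omega>) y"
    unfolding y_def prox_step_def arg_min_on_def arg_min_def prox_objective_def[abs_def] by (rule someI_ex)
  then have y: "y \<in> \<Omega>" and min: "\<And>z. z \<in> \<Omega> \<Longrightarrow> ?q y \<le> ?q z"
    by (auto simp: is_arg_min_linorder)
  show "prox_step \<Omega> x \<omega> \<gamma> \<in> \<Omega>"
    using y by (simp add: y_def)
  show "?q (prox_step \<Omega> x \<omega> \<gamma>) \<le> ?q z" if "z \<in> \<Omega>"
    using min[OF that] by (simp add: y_def)
  show "(\<omega> + (1 / \<gamma>) *\<^sub>R (prox_step \<Omega> x \<omega> \<gamma> - x)) \<bullet> (prox_step \<Omega> x \<omega> \<gamma> - z) \<le> 0" if z: "z \<in> \<Omega>"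
  proof -
    have "0 \<le> (\<omega> + (1 / \<gamma>) *\<^sub>R (y - x)) \<bullet> (z - y)"
    proof (rule nonneg_of_linear_plus_quadratic)
      fix t :: real assume t: "0 < t" "t \<le> 1"
      have "y + t *\<^sub>R (z - y) \<in> \<Omega>"
        using convexD[OF \<open>convex \<Omega>\<close> y z, of "1 - t" t] t by (simp add: algebra_simps)
      from min[OF this] have "0 \<le> prox_objective x \<omega> \<gamma> (y + t *\<^sub>R (z - y)) - prox_objective x \<omega> \<gamma> y"
        by simp
      also have "\<dots> = t * ((\<omega> + (1 / \<gamma>) *\<^sub>R (y - x)) \<bullet> (z - y)) + t\<^sup>2 * (1 / (2 * \<gamma>) * (norm (z - y))\<^sup>2)"
        by (simp add: prox_objective_line)
      finally show "0 \<le> t * ((\<omega> + (1 / \<gamma>) *\<^sub>R (y - x)) \<bullet> (z - y)) + t\<^sup>2 * (1 / (2 * \<gamma>) * (norm (z - y))\<^sup>2)" .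
    qed
    then show ?thesis
      unfolding y_def[symmetric] by (simp add: inner_diff_right)
  qed
qed

section \<open>Frank-Wolfe with exact line search, as recurrences on real sequences\<close>

text \<open>\<open>min 1 (a / q)\<close> is the vertex of the parabola - s a + s^2 q / 2 clipped to
  [0, 1]. For \<open>q = 0\<close> the quotient is 0 by convention, and the parabola is constant
  because \<open>a = 0\<close>.\<close>

lemma clipped_vertex_minimal:
  fixes a q :: real
  assumes "0 \<le> a" "0 \<le> q" and zero: "q = 0 \<Longrightarrow> a = 0" and "0 \<le> \<xi>" "\<xi> \<le> 1"
  shows "min 1 (a / q) \<in> {0..1}"
    and "- min 1 (a / q) * a + (min 1 (a / q))\<^sup>2 * q / 2 \<le> - \<xi> * a + \<xi>\<^sup>2 * q / 2"
proof -
  show "min 1 (a / q) \<in> {0..1}"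
    using assms by auto
  show "- min 1 (a / q) * a + (min 1 (a / q))\<^sup>2 * q / 2 \<le> - \<xi> * a + \<xi>\<^sup>2 * q / 2"
  proof (cases "q = 0")
    case True
    then show ?thesis using zero by simp
  next
    case False
    then have q: "q > 0" using assms by simp
    \<comment> \<open>Expansion around \<open>s\<close>, whose first term is the slope at
      \<open>s\<close> times the displacement; at the clipped vertex this term is
      nonnegative.\<close>
    have *: "- \<xi> * a + \<xi>\<^sup>2 * q / 2 - (- s * a + s\<^sup>2 * q / 2)
        = (\<xi> - s) * (s * q - a) + q / 2 * (\<xi> - s)\<^sup>2" for s
      by (simp add: power2_eq_square algebra_simps)
    have "0 \<le> (\<xi> - min 1 (a / q)) * (min 1 (a / q) * q - a)"
    proof (cases "a / q \<le> 1")
      case True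
      then show ?thesis using q by (simp add: min_def)
    next
      case False
      then have "min 1 (a / q) = 1" "q \<le> a"
        using q by (auto simp: field_simps)
      then show ?thesis
        using assms by (auto simp: mult_nonpos_nonpos)
    qed
    then show ?thesis
      using *[of "min 1 (a / q)"] q by (smt (verit) mult_nonneg_nonneg half_gt_zero_iff zero_le_power2)
  qed
qed

text \<open>\<open>h\<close> is the primal gap, \<open>G\<close> the duality gap, \<open>M\<close> a
  curvature bound. Exact line search does at least as well as every fixed \<xi>, so the proof may
  insert its own: 1 at the start, which cancels \<open>h 0\<close>, then 2/(k+3) in the
  induction.\<close>

lemma frank_wolfe_rate:
  fixes h G :: "nat \<Rightarrow> real"
  assumes gap: "\<And>k. h k \<le> G k"
    and step: "\<And>k \<xi>. 0 \<le> \<xi> \<Longrightarrow> \<xi> \<le> 1 \<Longrightarrow> h (Suc k) \<le> h k - \<xi> * G k + \<xi>\<^sup>2 * M / 2"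
    and "M \<ge> 0"
  shows "h (Suc k) \<le> 2 * M / (real k + 2)"
proof (induction k)
  case 0
  show ?case using step[of 1 0] gap[of 0] \<open>M \<ge> 0\<close> by simp
next
  case (Suc k)
  define r where "r = real k + 3"
  have r: "r \<ge> 3" by (simp add: r_def)
  define \<xi> where "\<xi> = 2 / r"
  have \<xi>: "0 \<le> \<xi>" "\<xi> \<le> 1" using r by (auto simp: \<xi>_def)
  have "h (Suc (Suc k)) \<le> h (Suc k) - \<xi> * G (Suc k) + \<xi>\<^sup>2 * M / 2"
    using step[OF \<xi>] .
  also have "\<dots> \<le> (1 - \<xi>) * h (Suc k) + \<xi>\<^sup>2 * M / 2"
    using mult_left_mono[OF gap[of "Suc k"] \<xi>(1)] by (simp add: algebra_simps)
  also have "\<dots> \<le> (1 - \<xi>) * (2 * M / (r - 1)) + \<xi>\<^sup>2 * M / 2"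
    using Suc.IH \<xi> by (intro add_mono mult_left_mono) (auto simp: r_def add.commute)
  also have "\<dots> \<le> 2 * M / r"
  proof -
    have "2 * M / r - ((1 - \<xi>) * (2 * M / (r - 1)) + \<xi>\<^sup>2 * M / 2) = 2 * M / (r\<^sup>2 * (r - 1))"
      using r unfolding \<xi>_def by (simp add: divide_simps) (simp add: power2_eq_square algebra_simps)
    also have "\<dots> \<ge> 0" using r \<open>M \<ge> 0\<close> by simp
    finally show ?thesis by simp
  qed
  finally show ?case by (simp add: r_def add.commute)
qed

text \<open>After \<open>N\<close> steps the primal gap is at most \<xi> M with \<xi> = 2/(N+1). If
  the duality gap stayed above \<eta>, each of the next \<open>N\<close> steps with this \<xi> would
  remove at least \<xi> \<eta> - \<xi>^2 M / 2, in total at least 2 \<xi> M - \<xi> M, which leaves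
  a negative primal gap.\<close>

lemma frank_wolfe_gap_small:
  fixes h G :: "nat \<Rightarrow> real"
  assumes nonneg: "\<And>k. 0 \<le> h k" and gap: "\<And>k. h k \<le> G k"
    and step: "\<And>k \<xi>. 0 \<le> \<xi> \<Longrightarrow> \<xi> \<le> 1 \<Longrightarrow> h (Suc k) \<le> h k - \<xi> * G k + \<xi>\<^sup>2 * M / 2"
    and "M \<ge> 0" and N: "N \<ge> 1" "2 * M \<le> real N * \<eta>"
  shows "\<exists>k\<le>2 * N. G k \<le> \<eta>"
proof (rule ccontr)
  assume "\<not> ?thesis"
  then have large: "G k > \<eta>" if "k \<le> 2 * N" for k
    using that by (metis not_le)
  define \<xi> where "\<xi> = 2 / (real N + 1)"
  have \<xi>: "0 < \<xi>" "\<xi> \<le> 1" using N by (auto simp: \<xi>_def)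
  have "h (N + j) \<le> h N - real j * (\<xi> * \<eta> - \<xi>\<^sup>2 * M / 2)" if "j \<le> N" for j
    using that
  proof (induction j)
    case (Suc j)
    have "\<xi> * \<eta> \<le> \<xi> * G (N + j)"
      using \<xi> large[of "N + j"] Suc.prems by (intro mult_left_mono) auto
    moreover have "h (Suc (N + j)) \<le> h (N + j) - \<xi> * G (N + j) + \<xi>\<^sup>2 * M / 2"
      using step[of \<xi>] \<xi> by simp
    moreover have "h (N + j) \<le> h N - real j * (\<xi> * \<eta> - \<xi>\<^sup>2 * M / 2)"
      using Suc by simp
    moreover have "real (Suc j) * (\<xi> * \<eta> - \<xi>\<^sup>2 * M / 2)
        = (\<xi> * \<eta> - \<xi>\<^sup>2 * M / 2) + real j * (\<xi> * \<eta> - \<xi>\<^sup>2 * M / 2)"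
      by (simp add: algebra_simps)
    ultimately have "h (Suc (N + j)) \<le> h N - real (Suc j) * (\<xi> * \<eta> - \<xi>\<^sup>2 * M / 2)"
      by linarith
    then show ?case by simp
  qed simp
  \<comment> \<open>The last step is split off to keep one strict inequality; with non-strict ones
    the total decrease could exactly match \<open>h N\<close>.\<close>
  moreover obtain p where p: "N = Suc p"
    using N by (cases N) auto
  ultimately have "h (N + p) \<le> h N - real p * (\<xi> * \<eta> - \<xi>\<^sup>2 * M / 2)"
    by simp
  moreover have "h (Suc (N + p)) \<le> h (N + p) - \<xi> * G (N + p) + \<xi>\<^sup>2 * M / 2"
    using step[of \<xi>] \<xi> by simp
  moreover have "\<xi> * \<eta> < \<xi> * G (N + p)"
    using \<xi> large[of "N + p"] p by simp
  moreover have "real N * (\<xi> * \<eta> - \<xi>\<^sup>2 * M / 2)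
      = (\<xi> * \<eta> - \<xi>\<^sup>2 * M / 2) + real p * (\<xi> * \<eta> - \<xi>\<^sup>2 * M / 2)"
    by (simp add: p algebra_simps)
  ultimately have "0 < h N - real N * (\<xi> * \<eta> - \<xi>\<^sup>2 * M / 2)"
    using nonneg[of "Suc (N + p)"] by linarith
  moreover have "h N \<le> \<xi> * M"
    using frank_wolfe_rate[where h = h and G = G and k = "N - 1", OF gap step \<open>M \<ge> 0\<close>] N by (simp add: \<xi>_def of_nat_diff add.commute)
  moreover have "real N * (\<xi>\<^sup>2 * M / 2) \<le> \<xi> * M"
  proof -
    have "real N * \<xi> \<le> 2" by (simp add: \<xi>_def field_simps)
    then have "(real N * \<xi>) * (\<xi> * M / 2) \<le> 2 * (\<xi> * M / 2)"
      using \<xi> \<open>M \<ge> 0\<close> by (intro mult_right_mono) auto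
    then show ?thesis by (simp add: power2_eq_square mult_ac)
  qed
  moreover have "\<xi> * (2 * M) \<le> \<xi> * (real N * \<eta>)"
    using N \<xi> by (intro mult_left_mono) auto
  ultimately show False by (simp add: algebra_simps)
qed

section \<open>The conditional gradient procedure\<close>

lemma linear_oracle_in: "linear_oracle \<Omega> lo \<Longrightarrow> lo w \<in> \<Omega>"
  by (simp add: linear_oracle_def is_arg_min_linorder)

lemma linear_oracle_le: "linear_oracle \<Omega> lo \<Longrightarrow> z \<in> \<Omega> \<Longrightarrow> w \<bullet> lo w \<le> w \<bullet> z"
  by (simp add: linear_oracle_def is_arg_min_linorder inner_commute)

text \<open>The supremum is attained at the oracle's answer to the same query that
  \<open>condg_step\<close> makes, so a single call serves both the stopping test and the
  direction.\<close>

lemma condg_gap_eq: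
  assumes "linear_oracle \<Omega> lo"
  shows "condg_gap \<Omega> w u lam z =
    (w + (1 / lam) *\<^sub>R (z - u)) \<bullet> (z - lo (w + (1 / lam) *\<^sub>R (z - u)))"
  unfolding condg_gap_def
  by (rule cSup_eq_maximum)
    (use linear_oracle_in[OF assms] linear_oracle_le[OF assms] in \<open>auto simp: inner_diff_right\<close>)

lemma condg_gap_ge:
  assumes "linear_oracle \<Omega> lo" "x \<in> \<Omega>"
  shows "(w + (1 / lam) *\<^sub>R (z - u)) \<bullet> (z - x) \<le> condg_gap \<Omega> w u lam z"
  using linear_oracle_le[OF assms] by (simp add: condg_gap_eq[OF assms(1)] inner_diff_right)

context
  fixes \<Omega> :: "'a::euclidean_space set" and lo :: "'a \<Rightarrow> 'a" and lam D :: real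
  assumes compact: "compact \<Omega>" and convex: "convex \<Omega>" and diameter: "diameter \<Omega> \<le> D"
    and lo: "linear_oracle \<Omega> lo" and lam: "lam > 0"
begin

lemma dist_le_diameter: "x \<in> \<Omega> \<Longrightarrow> y \<in> \<Omega> \<Longrightarrow> norm (x - y) \<le> D"
  using diameter_bounded_bound[OF compact_imp_bounded[OF compact], of x y] diameter
  by (simp add: dist_norm)

text \<open>The step size is \<open>G / q\<close> clipped at 1, with \<open>G\<close> the duality
  gap and \<open>q\<close> the curvature along the direction: an exact line search. The diameter
  replaces \<open>q\<close> by the uniform \<open>D\<^sup>2 / lam\<close>.\<close>

lemma condg_step:
  assumes z: "z \<in> \<Omega>"
  shows condg_step_in: "condg_step lo w u lam z \<in> \<Omega>"
    and condg_step_decrease: "0 \<le> \<xi> \<Longrightarrow> \<xi> \<le> 1 \<Longrightarrow>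
      prox_objective u w lam (condg_step lo w u lam z)
        \<le> prox_objective u w lam z - \<xi> * condg_gap \<Omega> w u lam z + \<xi>\<^sup>2 * (D\<^sup>2 / lam) / 2"
proof -
  define c where "c = w + (1 / lam) *\<^sub>R (z - u)"
  define d where "d = lo c - z"
  define q where "q = (1 / lam) * (norm d)\<^sup>2"
  define G where "G = condg_gap \<Omega> w u lam z"
  define s where "s = min 1 (G / q)"
  have G: "G = - (c \<bullet> d)"
    unfolding G_def condg_gap_eq[OF lo] by (simp add: c_def d_def inner_diff_right)
  have "((1 / lam) *\<^sub>R (u - z) - w) \<bullet> d = G"
    unfolding G c_def by (simp add: inner_add_left inner_diff_left scaleR_diff_right)
  then have step: "condg_step lo w u lam z = z + s *\<^sub>R d"
    unfolding condg_step_def Let_def s_def c_def[symmetric] q_def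
    unfolding d_def by (simp add: algebra_simps)
  have "0 \<le> G"
    using condg_gap_ge[OF lo z, of w lam z u] by (simp add: G_def)
  have q: "0 \<le> q" "q = 0 \<Longrightarrow> G = 0"
    using lam by (auto simp: q_def G)
  have "s \<in> {0..1}"
    unfolding s_def by (rule clipped_vertex_minimal(1)[OF \<open>0 \<le> G\<close> q, of 0]) auto
  then show "condg_step lo w u lam z \<in> \<Omega>"
    using convexD[OF convex z linear_oracle_in[OF lo, of c], of "1 - s" s]
    by (simp add: step d_def algebra_simps)
  show "prox_objective u w lam (condg_step lo w u lam z)
        \<le> prox_objective u w lam z - \<xi> * condg_gap \<Omega> w u lam z + \<xi>\<^sup>2 * (D\<^sup>2 / lam) / 2"
    if \<xi>: "0 \<le> \<xi>" "\<xi> \<le> 1"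
  proof -
    have "q \<le> D\<^sup>2 / lam"
      using dist_le_diameter[OF linear_oracle_in[OF lo] z, of c] lam
      by (auto simp: q_def d_def divide_simps intro: power_mono)
    then have "\<xi>\<^sup>2 * q / 2 \<le> \<xi>\<^sup>2 * (D\<^sup>2 / lam) / 2"
      by (intro divide_right_mono mult_left_mono) auto
    moreover have "- s * G + s\<^sup>2 * q / 2 \<le> - \<xi> * G + \<xi>\<^sup>2 * q / 2"
      unfolding s_def by (rule clipped_vertex_minimal(2)[OF \<open>0 \<le> G\<close> q \<xi>])
    moreover have "prox_objective u w lam (z + s *\<^sub>R d) = prox_objective u w lam z - s * G + s\<^sup>2 * q / 2"
      unfolding prox_objective_line c_def[symmetric] G q_def by simp
    ultimately show ?thesis
      unfolding step G_def[symmetric] by linarith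
  qed
qed

lemma condg_iterate_in: "u \<in> \<Omega> \<Longrightarrow> condg_iterate lo w u lam k \<in> \<Omega>"
  unfolding condg_iterate_def by (induction k) (auto intro: condg_step_in)

lemma condg_stops_early:
  assumes u: "u \<in> \<Omega>" and N: "N \<ge> 1" "2 * (D\<^sup>2 / lam) \<le> real N * \<eta>"
  shows "\<exists>k\<le>2 * N. condg_stops \<Omega> lo w u lam \<eta> k"
proof -
  define y where "y = prox_step \<Omega> u w lam"
  define z where "z k = condg_iterate lo w u lam k" for k
  define h where "h k = prox_objective u w lam (z k) - prox_objective u w lam y" for k
  have z: "z k \<in> \<Omega>" for k
    unfolding z_def by (rule condg_iterate_in[OF u])
  have "\<Omega> \<noteq> {}" using u by auto
  note prox = compact convex this lam
  have "\<exists>k\<le>2 * N. condg_gap \<Omega> w u lam (z k) \<le> \<eta>"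
  proof (rule frank_wolfe_gap_small[OF _ _ _ _ N])
    show "0 \<le> h k" for k
      using prox_step_le[OF prox z] by (simp add: h_def y_def)
    show "h k \<le> condg_gap \<Omega> w u lam (z k)" for k
    proof -
      define c where "c = w + (1 / lam) *\<^sub>R (z k - u)"
      have "c \<bullet> (z k - y) \<le> condg_gap \<Omega> w u lam (z k)"
        unfolding c_def by (rule condg_gap_ge[OF lo]) (simp add: y_def prox_step_in[OF prox])
      \<comment> \<open>The exact expansion with \<open>t = 1\<close> towards the minimizer;
        discarding its square term is the usual convexity argument for primal gap \<le> duality
        gap.\<close>
      moreover have "prox_objective u w lam y
          = prox_objective u w lam (z k) + c \<bullet> (y - z k) + 1 / (2 * lam) * (norm (y - z k))\<^sup>2"
        using prox_objective_line[of u w lam "z k" 1 "y - z k"] by (simp add: c_def)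
      moreover have "0 \<le> 1 / (2 * lam) * (norm (y - z k))\<^sup>2"
        using lam by simp
      ultimately show ?thesis
        unfolding h_def inner_diff_right by linarith
    qed
    show "h (Suc k) \<le> h k - \<xi> * condg_gap \<Omega> w u lam (z k) + \<xi>\<^sup>2 * (D\<^sup>2 / lam) / 2"
      if "0 \<le> \<xi>" "\<xi> \<le> 1" for k \<xi>
      using condg_step_decrease[where u = u and w = w, OF z that, of k] by (simp add: h_def z_def condg_iterate_def)
  qed (use lam in simp)
  then show ?thesis
    by (simp add: condg_stops_def z_def)
qed

lemma condg_spec:
  assumes u: "u \<in> \<Omega>" and N: "N \<ge> 1" "2 * (D\<^sup>2 / lam) \<le> real N * \<eta>"
  shows condg_in: "condg \<Omega> lo w u lam \<eta> \<in> \<Omega>"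
    and condg_variational: "z \<in> \<Omega> \<Longrightarrow>
      (w + (1 / lam) *\<^sub>R (condg \<Omega> lo w u lam \<eta> - u)) \<bullet> (condg \<Omega> lo w u lam \<eta> - z) \<le> \<eta>"
    and condg_lo_calls_le: "condg_lo_calls \<Omega> lo w u lam \<eta> \<le> enat (2 * N + 1)"
proof -
  obtain k where k: "k \<le> 2 * N" "condg_stops \<Omega> lo w u lam \<eta> k"
    using condg_stops_early[OF assms] by auto
  define l where "l = (LEAST k. condg_stops \<Omega> lo w u lam \<eta> k)"
  have l: "condg_stops \<Omega> lo w u lam \<eta> l" "l \<le> 2 * N"
    unfolding l_def using k by (auto intro: LeastI Least_le[THEN order_trans])
  show "condg \<Omega> lo w u lam \<eta> \<in> \<Omega>"
    unfolding condg_def by (rule condg_iterate_in[OF u])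
  show "(w + (1 / lam) *\<^sub>R (condg \<Omega> lo w u lam \<eta> - u)) \<bullet> (condg \<Omega> lo w u lam \<eta> - z) \<le> \<eta>" if "z \<in> \<Omega>"
    using l(1) condg_gap_ge[OF lo that, of w lam "condg \<Omega> lo w u lam \<eta>" u]
    by (simp add: condg_stops_def condg_def l_def)
  \<comment> \<open>Iterates are counted from zero, so stopping at an index of at most
    \<open>2 * N\<close> means at most \<open>2 * N + 1\<close> tested gaps.\<close>
  show "condg_lo_calls \<Omega> lo w u lam \<eta> \<le> enat (2 * N + 1)"
    using k l(2) unfolding condg_lo_calls_def l_def by auto
qed

end

section \<open>Descent in one inexact proximal step\<close>

text \<open>With a = p - x and e = y - x, the linear term of the quadratic bound splits as g.e = g.a
  + v.(e - a) + (g - v).(e - a). The exact condition bounds the first part, the inexact one the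
  second. Young's weight 1/(6 L) on the third makes its
  \<open>3 * L / 2 * (norm (e - a))\<^sup>2\<close> cancel the square from the three-point
  identity.\<close>

lemma inexact_prox_descent:
  assumes L: "L > 0" and F: "L_smooth_on \<Omega> L F" "convex \<Omega>" "x \<in> \<Omega>" "y \<in> \<Omega>"
    and exact: "(gradient F x + (3 * L) *\<^sub>R (p - x)) \<bullet> (p - x) \<le> 0"
    and inexact: "(v + (3 * L) *\<^sub>R (y - x)) \<bullet> (y - p) \<le> \<eta>"
  shows "F y \<le> F x - 3 * L / 2 * (norm (p - x))\<^sup>2 - L * (norm (y - x))\<^sup>2
    + (norm (gradient F x - v))\<^sup>2 / (6 * L) + \<eta>"
proof -
  define a e g where "a = p - x" and "e = y - x" and "g = gradient F x"
  have yp: "y - p = e - a" by (simp add: a_def e_def)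
  have 1: "g \<bullet> a \<le> - (3 * L * (norm a)\<^sup>2)"
    using exact unfolding a_def[symmetric] g_def[symmetric]
    by (simp add: inner_add_left power2_norm_eq_inner)
  have 2: "v \<bullet> (e - a) \<le> \<eta> - 3 * L * (e \<bullet> (e - a))"
    using inexact unfolding yp e_def[symmetric] by (simp add: inner_add_left)
  have 3: "3 * L * (e \<bullet> (e - a))
      = 3 * L / 2 * (norm e)\<^sup>2 + 3 * L / 2 * (norm (e - a))\<^sup>2 - 3 * L / 2 * (norm a)\<^sup>2"
  proof -
    have "2 * (e \<bullet> (e - a)) = (norm e)\<^sup>2 + (norm (e - a))\<^sup>2 - (norm a)\<^sup>2"
      unfolding power2_norm_eq_inner by (simp add: inner_diff_left inner_diff_right inner_commute)
    then have "3 * L / 2 * (2 * (e \<bullet> (e - a))) = 3 * L / 2 * ((norm e)\<^sup>2 + (norm (e - a))\<^sup>2 - (norm a)\<^sup>2)"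
      by (simp only:)
    then show ?thesis
      by (simp add: algebra_simps)
  qed
  have 4: "(g - v) \<bullet> (e - a) \<le> (norm (g - v))\<^sup>2 / (6 * L) + 3 * L / 2 * (norm (e - a))\<^sup>2"
  proof -
    have "0 \<le> (norm (g - v) - 3 * L * norm (e - a))\<^sup>2 / (6 * L)"
      using L by simp
    also have "\<dots> = (norm (g - v))\<^sup>2 / (6 * L) + 3 * L / 2 * (norm (e - a))\<^sup>2 - norm (g - v) * norm (e - a)"
      using L by (simp add: power2_diff field_simps) (simp add: power2_eq_square)
    finally show ?thesis
      using norm_cauchy_schwarz[of "g - v" "e - a"] by linarith
  qed
  have "F y \<le> F x + g \<bullet> e + L / 2 * (norm e)\<^sup>2"
    using L_smooth_on_quadratic_upper_bound[OF F] by (simp add: g_def e_def)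
  moreover have "g \<bullet> e = g \<bullet> a + v \<bullet> (e - a) + (g - v) \<bullet> (e - a)"
    by (simp add: inner_diff_left inner_diff_right)
  ultimately show ?thesis
    using 1 2 3 4 unfolding a_def[symmetric] e_def[symmetric] g_def[symmetric] by argo
qed

lemma norm_add_power2_le:
  fixes a d :: "'a::euclidean_space"
  assumes "\<beta> > 0"
  shows "(norm (a + d))\<^sup>2 \<le> (1 + \<beta>) * (norm a)\<^sup>2 + (1 + 1 / \<beta>) * (norm d)\<^sup>2"
proof -
  have "0 \<le> (\<beta> * norm a - norm d)\<^sup>2 / \<beta>"
    using assms by simp
  also have "\<dots> = \<beta> * (norm a)\<^sup>2 + 1 / \<beta> * (norm d)\<^sup>2 - 2 * (norm a * norm d)"
    using assms by (simp add: power2_diff field_simps) (simp add: power2_eq_square)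
  finally have "2 * (norm a * norm d) \<le> \<beta> * (norm a)\<^sup>2 + 1 / \<beta> * (norm d)\<^sup>2"
    by simp
  moreover have "(norm (a + d))\<^sup>2 \<le> (norm a + norm d)\<^sup>2"
    by (intro power_mono norm_triangle_ineq) simp
  ultimately show ?thesis
    by (simp add: power2_sum algebra_simps)
qed

section \<open>Finite expectations and the minibatch variance\<close>

text \<open>All distributions of a run have finite support, since each draw is from finitely many
  indices. Integrability is then automatic and conditioning is a finite sum.\<close>

lemma expectation_bind_finite:
  fixes h :: "'b \<Rightarrow> real"
  assumes "finite (set_pmf p)" "\<And>x. x \<in> set_pmf p \<Longrightarrow> finite (set_pmf (q x))"
  shows "measure_pmf.expectation (p \<bind> q) h =
    measure_pmf.expectation p (\<lambda>x. measure_pmf.expectation (q x) h)"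
  using assms
  by (subst pmf_expectation_bind[of "set_pmf p"]) (auto simp: integral_measure_pmf[of "set_pmf p"])

lemma expectation_mono_finite:
  fixes g h :: "'a \<Rightarrow> real"
  assumes "finite (set_pmf p)" "\<And>x. x \<in> set_pmf p \<Longrightarrow> g x \<le> h x"
  shows "measure_pmf.expectation p g \<le> measure_pmf.expectation p h"
  using assms
  by (intro integral_mono_AE) (auto simp: AE_measure_pmf_iff intro: integrable_measure_pmf_finite)

lemma finite_set_replicate_pmf:
  assumes "finite (set_pmf p)"
  shows "finite (set_pmf (replicate_pmf k p))"
  using finite_lists_length_eq[OF assms] by (simp add: set_replicate_pmf in_lists_conv_set subset_eq)

text \<open>Second moments of independent centred vectors add up. In the induction the cross terms
  sum to the total of \<open>a\<close> over \<open>A\<close> paired with one fixed vector, hence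
  vanish whatever the mean of the remaining draws is.\<close>

lemma expectation_norm_sum_replicate_pmf:
  fixes a :: "'i \<Rightarrow> 'a::euclidean_space"
  assumes A: "finite A" "A \<noteq> {}" and a: "(\<Sum>i\<in>A. a i) = 0"
  shows "measure_pmf.expectation (replicate_pmf k (pmf_of_set A)) (\<lambda>I. (norm (\<Sum>i\<leftarrow>I. a i))\<^sup>2)
    = real k * ((\<Sum>i\<in>A. (norm (a i))\<^sup>2) / card A)"
proof (induction k)
  case (Suc k)
  let ?R = "replicate_pmf k (pmf_of_set A)"
  have fin: "finite (set_pmf (replicate_pmf k (pmf_of_set A)))" for k
    using A by (intro finite_set_replicate_pmf) simp
  note int = integrable_measure_pmf_finite[OF fin]
  define s where "s I = (\<Sum>i\<leftarrow>I. a i)" for I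
  have "measure_pmf.expectation (replicate_pmf (Suc k) (pmf_of_set A)) (\<lambda>I. (norm (s I))\<^sup>2)
      = (\<Sum>i\<in>A. measure_pmf.expectation ?R (\<lambda>I. (norm (a i + s I))\<^sup>2)) / card A"
    using A fin by (simp add: expectation_bind_finite integral_pmf_of_set s_def)
  also have "(\<Sum>i\<in>A. measure_pmf.expectation ?R (\<lambda>I. (norm (a i + s I))\<^sup>2))
      = (\<Sum>i\<in>A. (norm (a i))\<^sup>2 + 2 * (a i \<bullet> measure_pmf.expectation ?R s)
          + measure_pmf.expectation ?R (\<lambda>I. (norm (s I))\<^sup>2))"
  proof (rule sum.cong)
    fix i
    have "(norm (a i + s I))\<^sup>2 = (norm (a i))\<^sup>2 + 2 * (a i \<bullet> s I) + (norm (s I))\<^sup>2" for I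
      by (simp add: power2_norm_eq_inner inner_add_left inner_add_right inner_commute)
    then show "measure_pmf.expectation ?R (\<lambda>I. (norm (a i + s I))\<^sup>2)
      = (norm (a i))\<^sup>2 + 2 * (a i \<bullet> measure_pmf.expectation ?R s)
          + measure_pmf.expectation ?R (\<lambda>I. (norm (s I))\<^sup>2)"
      by (simp add: int)
  qed simp
  also have "\<dots> = (\<Sum>i\<in>A. (norm (a i))\<^sup>2) + card A * (real k * ((\<Sum>i\<in>A. (norm (a i))\<^sup>2) / card A))"
    using Suc.IH a by (simp add: sum.distrib s_def flip: sum_distrib_left inner_sum_left)
  finally show ?case
    using A by (simp add: s_def field_simps)
qed simp

lemma minibatch_variance:
  fixes X :: "'i \<Rightarrow> 'a::euclidean_space"
  assumes A: "finite A" "A \<noteq> {}" and "k > 0" and X: "\<And>i. i \<in> A \<Longrightarrow> norm (X i) \<le> B"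
  shows "measure_pmf.expectation (replicate_pmf k (pmf_of_set A))
      (\<lambda>I. (norm ((1 / card A) *\<^sub>R (\<Sum>i\<in>A. X i) - (1 / real k) *\<^sub>R (\<Sum>i\<leftarrow>I. X i)))\<^sup>2) \<le> B\<^sup>2 / k"
proof -
  let ?R = "replicate_pmf k (pmf_of_set A)"
  define \<mu> where "\<mu> = (1 / card A) *\<^sub>R (\<Sum>i\<in>A. X i)"
  define a where "a i = X i - \<mu>" for i
  have card: "card A > 0" using A by (simp add: card_gt_0_iff)
  have sum_X: "(\<Sum>i\<in>A. X i) = card A *\<^sub>R \<mu>"
    using card by (simp add: \<mu>_def)
  have "(\<Sum>i\<in>A. a i) = 0"
    by (simp add: a_def sum_subtractf sum_X sum_constant_scaleR)
  note var = expectation_norm_sum_replicate_pmf[OF A this]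
  have sum_a: "(\<Sum>i\<leftarrow>I. a i) = (\<Sum>i\<leftarrow>I. X i) - length I *\<^sub>R \<mu>" for I
    by (induction I) (auto simp: a_def algebra_simps)
  have "measure_pmf.expectation ?R (\<lambda>I. (norm (\<mu> - (1 / real k) *\<^sub>R (\<Sum>i\<leftarrow>I. X i)))\<^sup>2)
      = measure_pmf.expectation ?R (\<lambda>I. (1 / real k)\<^sup>2 * (norm (\<Sum>i\<leftarrow>I. a i))\<^sup>2)"
  \<comment> \<open>Centring the batch subtracts the mean \<open>length I\<close> times, so the
    integrands agree only on lists of length \<open>k\<close>, which are all that the support
    contains.\<close>
  proof (intro integral_cong_AE)
    have "(norm (\<mu> - (1 / real k) *\<^sub>R (\<Sum>i\<leftarrow>I. X i)))\<^sup>2 = (1 / real k)\<^sup>2 * (norm (\<Sum>i\<leftarrow>I. a i))\<^sup>2"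
      if "length I = k" for I
    proof -
      have "\<mu> - (1 / real k) *\<^sub>R (\<Sum>i\<leftarrow>I. X i) = - ((1 / real k) *\<^sub>R (\<Sum>i\<leftarrow>I. a i))"
        using \<open>k > 0\<close> that by (simp add: sum_a algebra_simps)
      then show ?thesis
        by (simp only: norm_minus_cancel norm_scaleR) (simp add: power_mult_distrib power_divide)
    qed
    then show "AE I in ?R. (norm (\<mu> - (1 / real k) *\<^sub>R (\<Sum>i\<leftarrow>I. X i)))\<^sup>2
        = (1 / real k)\<^sup>2 * (norm (\<Sum>i\<leftarrow>I. a i))\<^sup>2"
      by (simp add: AE_measure_pmf_iff set_replicate_pmf)
  qed simp_all
  also have "\<dots> = (\<Sum>i\<in>A. (norm (a i))\<^sup>2) / (card A * k)"
    using \<open>k > 0\<close> by (simp add: var) (simp add: power2_eq_square)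
  \<comment> \<open>Subtracting the mean can only lower the second moment.\<close>
  also have "(\<Sum>i\<in>A. (norm (a i))\<^sup>2) \<le> card A * B\<^sup>2"
  proof -
    have "(\<Sum>i\<in>A. (norm (a i))\<^sup>2) = (\<Sum>i\<in>A. (norm (X i))\<^sup>2 - 2 * (X i \<bullet> \<mu>) + \<mu> \<bullet> \<mu>)"
      by (intro sum.cong)
        (simp_all add: a_def power2_norm_eq_inner inner_diff_left inner_diff_right inner_commute)
    also have "\<dots> = (\<Sum>i\<in>A. (norm (X i))\<^sup>2) - card A * (\<mu> \<bullet> \<mu>)"
      by (simp add: sum.distrib sum_subtractf sum_X flip: sum_distrib_left inner_sum_left)
    also have "\<dots> \<le> (\<Sum>i\<in>A. B\<^sup>2)"
      using sum_mono[of A "\<lambda>i. (norm (X i))\<^sup>2" "\<lambda>_. B\<^sup>2"] X by (simp add: power_mono algebra_simps add_increasing)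
    finally show ?thesis by simp
  qed
  then have "(\<Sum>i\<in>A. (norm (a i))\<^sup>2) / (card A * k) \<le> card A * B\<^sup>2 / (card A * k)"
    by (intro divide_right_mono) auto
  also have "\<dots> = B\<^sup>2 / k"
    using card by simp
  finally show ?thesis
    by (simp add: \<mu>_def)
qed

section \<open>The outer loop: invariant and potential\<close>

text \<open>\<open>N\<close> is not a parameter of the algorithm but a witness for its cost: the
  last assumption makes \<open>2 * N + 1\<close> oracle calls sufficient for each
  \<open>condg\<close> call.\<close>

locale ncgs_vr_setting =
  fixes \<Omega> :: "'a::euclidean_space set" and lo :: "'a \<Rightarrow> 'a" and f :: "nat \<Rightarrow> 'a \<Rightarrow> real"
    and L D \<eta> :: real and n m b N :: nat
  assumes compact: "compact \<Omega>" and convex: "convex \<Omega>" and diameter: "diameter \<Omega> \<le> D"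
    and lo: "linear_oracle \<Omega> lo" and L: "L > 0" and n: "n \<ge> 1"
    and smooth: "\<And>i. i \<in> {1..n} \<Longrightarrow> L_smooth_on \<Omega> L (f i)"
    and m: "m \<ge> 1" and batch: "m\<^sup>2 \<le> b"
    and N: "N \<ge> 1" "2 * (D\<^sup>2 / (1 / (3 * L))) \<le> real N * \<eta>"
begin

abbreviation "lam \<equiv> 1 / (3 * L)"

abbreviation "gm \<theta> \<equiv> grad_mapping \<Omega> \<theta> (gradient (avg f n) \<theta>) lam"

lemma lam_pos: "lam > 0"
  using L by simp

lemma b_pos: "b > 0"
proof -
  have "0 < m\<^sup>2" using m by simp
  then show ?thesis using batch by linarith
qed

lemmas condg_facts = condg_spec[OF compact convex diameter lo lam_pos _ N]

text \<open>A Lyapunov function. The distance to the snapshot pays for future variance; the sum over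
  \<open>visited\<close> books the gradient mappings already collected, so that telescoping reduces
  to one inequality per step: expected growth at most \<eta>.\<close>

definition potential :: "'a \<Rightarrow> nat \<Rightarrow> 'a run_state \<Rightarrow> real" where
  "potential snapshot t st = (case st of (\<theta>, visited, _, _) \<Rightarrow>
     avg f n \<theta> + L * (real m - real t) / (3 * real b) * (norm (\<theta> - snapshot))\<^sup>2
       + (\<Sum>x\<leftarrow>visited. (norm (gm x))\<^sup>2) / (6 * L))"

lemma finite_set_pmf_indices: "finite (set_pmf (replicate_pmf k (pmf_of_set {1..n})))"
  using n by (intro finite_set_replicate_pmf) simp

lemma finite_set_pmf_vr_inner:
  "finite (set_pmf (vr_inner \<Omega> lo f n b lm \<eta>' snapshot g t st))"
  by (induction t) (auto simp: finite_set_pmf_indices simp del: One_nat_def)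

lemma finite_set_pmf_vr_epochs:
  "finite (set_pmf (vr_epochs \<Omega> lo f n m b lm \<eta>' \<theta>\<^sub>0 s))"
  by (induction s) (auto simp: vr_epoch_def finite_set_pmf_vr_inner split: prod.splits)

text \<open>Meant for every state in the support after \<open>k\<close> inner steps, not for
  averages: the call bounds are worst-case, and all points stay in \<Omega>, where smoothness
  applies.\<close>

definition run_inv :: "nat \<Rightarrow> nat \<Rightarrow> 'a run_state \<Rightarrow> bool" where
  "run_inv k j st = (case st of (\<theta>, visited, ifo_calls, lo_calls) \<Rightarrow>
     \<theta> \<in> \<Omega> \<and> set visited \<subseteq> \<Omega> \<and> length visited = k \<and> ifo_calls = j \<and>
     lo_calls \<le> enat (k * (2 * N + 1)))"

lemma run_inv_vr_step:
  assumes "run_inv k j st"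
  shows "run_inv (Suc k) (j + 2 * b) (vr_step \<Omega> lo f b lam \<eta> snapshot g I st)"
proof -
  obtain \<theta> visited ic lc where st: "st = (\<theta>, visited, ic, lc)" by (cases st)
  have \<theta>: "\<theta> \<in> \<Omega>" using assms by (simp add: st run_inv_def)
  define B where "B = Suc k * (2 * N + 1)"
  have "lc + condg_lo_calls \<Omega> lo w \<theta> lam \<eta> \<le> enat B" for w
  proof -
    have "lc + condg_lo_calls \<Omega> lo w \<theta> lam \<eta> \<le> enat (k * (2 * N + 1)) + enat (2 * N + 1)"
      using assms by (intro add_mono condg_facts(3)[OF \<theta>]) (simp add: st run_inv_def)
    also have "\<dots> = enat B"
      by (simp add: B_def)
    finally show ?thesis .
  qed
  then show ?thesis
    using assms condg_facts(1)[OF \<theta>]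
    unfolding st vr_step_def run_inv_def Let_def prod.case B_def[symmetric] by simp
qed

lemma run_inv_vr_inner:
  assumes "run_inv k j st"
  shows "st' \<in> set_pmf (vr_inner \<Omega> lo f n b (\<lambda>_. lam) (\<lambda>_. \<eta>) snapshot g t st) \<Longrightarrow>
    run_inv (k + t) (j + t * (2 * b)) st'"
proof (induction t arbitrary: st')
  case (Suc t)
  then obtain st'' I where
    "st'' \<in> set_pmf (vr_inner \<Omega> lo f n b (\<lambda>_. lam) (\<lambda>_. \<eta>) snapshot g t st)"
    "st' = vr_step \<Omega> lo f b lam \<eta> snapshot g I st''"
    by auto
  with Suc.IH[of st''] run_inv_vr_step[of "k + t" "j + t * (2 * b)" st''] show ?case
    by (simp add: algebra_simps)
qed (use assms in simp)

lemma run_inv_vr_epochs: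
  assumes "\<theta>\<^sub>0 \<in> \<Omega>"
  shows "st \<in> set_pmf (vr_epochs \<Omega> lo f n m b (\<lambda>_. lam) (\<lambda>_. \<eta>) \<theta>\<^sub>0 s) \<Longrightarrow>
    run_inv (s * m) (s * (n + m * (2 * b))) st"
proof (induction s arbitrary: st)
  case 0
  then show ?case using assms by (simp add: run_inv_def zero_enat_def)
next
  case (Suc s)
  then obtain \<theta> visited ic lc where *:
    "(\<theta>, visited, ic, lc) \<in> set_pmf (vr_epochs \<Omega> lo f n m b (\<lambda>_. lam) (\<lambda>_. \<eta>) \<theta>\<^sub>0 s)"
    "st \<in> set_pmf (vr_epoch \<Omega> lo f n m b (\<lambda>_. lam) (\<lambda>_. \<eta>) (\<theta>, visited, ic, lc))"
    by auto
  have "run_inv (s * m) (s * (n + m * (2 * b)) + n) (\<theta>, visited, ic + n, lc)"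
    using Suc.IH[OF *(1)] by (simp add: run_inv_def)
  then have "run_inv (s * m + m) (s * (n + m * (2 * b)) + n + m * (2 * b)) st"
    using *(2) unfolding vr_epoch_def Let_def prod.case by (rule run_inv_vr_inner)
  then show ?case
    by (simp add: algebra_simps)
qed

lemma smooth_avg: "L_smooth_on \<Omega> L (avg f n)"
  using n smooth by (rule L_smooth_on_avg)

lemma gradient_avg: "x \<in> \<Omega> \<Longrightarrow> gradient (avg f n) x = (1 / real n) *\<^sub>R (\<Sum>i=1..n. gradient (f i) x)"
  using n smooth by (rule L_smooth_on_avg)

lemma condg_descent:
  assumes \<theta>: "\<theta> \<in> \<Omega>" and y: "y = condg \<Omega> lo v \<theta> lam \<eta>"
  shows "avg f n y \<le> avg f n \<theta> - (norm (gm \<theta>))\<^sup>2 / (6 * L) - L * (norm (y - \<theta>))\<^sup>2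
    + (norm (gradient (avg f n) \<theta> - v))\<^sup>2 / (6 * L) + \<eta>"
proof -
  define p where "p = prox_step \<Omega> \<theta> (gradient (avg f n) \<theta>) lam"
  have "\<Omega> \<noteq> {}" using \<theta> by auto
  note prox = compact convex this lam_pos
  have p: "p \<in> \<Omega>"
    unfolding p_def by (rule prox_step_in[OF prox])
  have "avg f n y \<le> avg f n \<theta> - 3 * L / 2 * (norm (p - \<theta>))\<^sup>2 - L * (norm (y - \<theta>))\<^sup>2
    + (norm (gradient (avg f n) \<theta> - v))\<^sup>2 / (6 * L) + \<eta>"
  proof (rule inexact_prox_descent[OF L smooth_avg convex \<theta>])
    show "y \<in> \<Omega>"
      unfolding y by (rule condg_facts(1)[OF \<theta>])
    show "(gradient (avg f n) \<theta> + (3 * L) *\<^sub>R (p - \<theta>)) \<bullet> (p - \<theta>) \<le> 0"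
      using prox_step_variational[OF prox \<theta>, of "gradient (avg f n) \<theta>" \<theta>] by (simp add: p_def)
    show "(v + (3 * L) *\<^sub>R (y - \<theta>)) \<bullet> (y - p) \<le> \<eta>"
      using condg_facts(2)[OF \<theta> p, of v] by (simp add: y)
  qed
  \<comment> \<open>The gradient mapping is 3 L (\<theta> - p), which explains the factor 1/(6
    L).\<close>
  moreover have "(norm (gm \<theta>))\<^sup>2 / (6 * L) = 3 * L / 2 * (norm (p - \<theta>))\<^sup>2"
    using L by (simp add: grad_mapping_def p_def norm_minus_commute power_mult_distrib power2_eq_square)
  ultimately show ?thesis by simp
qed

text \<open>The weight \<open>L (m - t) / (3 b)\<close> is chosen so that Young's inequality with parameter
  \<open>1 / (2 m)\<close> absorbs the variance term \<open>L |\<theta> - snapshot|\<^sup>2 / (6 b)\<close>,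
  while \<open>m\<^sup>2 \<le> b\<close> keeps the coefficient of \<open>|\<theta>' - \<theta>|\<^sup>2\<close> below \<open>L\<close>.\<close>

lemma potential_vr_step:
  assumes \<theta>: "\<theta> \<in> \<Omega>" and sn: "sn \<in> \<Omega>" and t: "t < m"
  shows "measure_pmf.expectation (replicate_pmf b (pmf_of_set {1..n}))
      (\<lambda>I. potential sn (Suc t) (vr_step \<Omega> lo f b lam \<eta> sn (gradient (avg f n) sn) I (\<theta>, visited, ic, lc)))
    \<le> potential sn t (\<theta>, visited, ic, lc) + \<eta>"
proof -
  let ?R = "replicate_pmf b (pmf_of_set {1..n})"
  define X where "X i = gradient (f i) \<theta> - gradient (f i) sn" for i
  define V where "V I = (norm ((1 / real n) *\<^sub>R (\<Sum>i=1..n. X i) - (1 / real b) *\<^sub>R (\<Sum>i\<leftarrow>I. X i)))\<^sup>2" for I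
  \<comment> \<open>The number of inner steps left after this one; \<open>c\<close> is thus the
    weight of the distance term in the potential after the step.\<close>
  define k where "k = real m - real (Suc t)"
  define c where "c = L * k / (3 * real b)"
  define r where "r = (norm (\<theta> - sn))\<^sup>2"
  define W where "W = (\<Sum>x\<leftarrow>visited. (norm (gm x))\<^sup>2) / (6 * L)"
  have m': "1 \<le> real m" using m by simp
  have b': "(real m)\<^sup>2 \<le> real b" "real b > 0"
    using batch b_pos by (simp_all flip: of_nat_power)
  have k: "0 \<le> k" "k \<le> real m - 1" using t by (auto simp: k_def)
  have c: "0 \<le> c" using k L by (simp add: c_def)
  have c_le: "c * (1 + 2 * real m) \<le> L"
  proof -
    have "k * (1 + 2 * real m) \<le> (real m - 1) * (1 + 2 * real m)"
      using k by (intro mult_right_mono) auto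
    also have "\<dots> \<le> 3 * (real m)\<^sup>2"
      by (simp add: power2_eq_square algebra_simps)
    also have "\<dots> \<le> 3 * real b"
      using b' by simp
    finally have "L * (k * (1 + 2 * real m)) \<le> L * (3 * real b)"
      using L by (intro mult_left_mono) auto
    then show ?thesis
      using b' by (simp add: c_def field_simps)
  qed
  have c_step: "c * (1 + 1 / (2 * real m)) + L / (6 * real b) \<le> L * (real m - real t) / (3 * real b)"
  proof -
    have "k / (2 * real m) \<le> 1 / 2"
      using k m' by (simp add: field_simps)
    then have "L / (3 * real b) * (k / (2 * real m)) \<le> L / (3 * real b) * (1 / 2)"
      using L by (intro mult_left_mono) auto
    moreover have "real m - real t = k + 1" by (simp add: k_def)
    ultimately show ?thesis
      by (simp add: c_def distrib_left add_divide_distrib)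
  qed
  have pointwise: "potential sn (Suc t) (vr_step \<Omega> lo f b lam \<eta> sn (gradient (avg f n) sn) I (\<theta>, visited, ic, lc))
      \<le> V I / (6 * L) + (avg f n \<theta> + \<eta> + c * (1 + 1 / (2 * real m)) * r + W)" for I
  proof -
    define v where "v = (1 / real b) *\<^sub>R (\<Sum>i\<leftarrow>I. gradient (f i) \<theta> - gradient (f i) sn) + gradient (avg f n) sn"
    define y where "y = condg \<Omega> lo v \<theta> lam \<eta>"
    \<comment> \<open>The snapshot gradient inside \<open>v\<close> turns the error into the
      deviation of a minibatch mean of \<open>X\<close> from its full mean.\<close>
    have "(norm (gradient (avg f n) \<theta> - v))\<^sup>2 = V I"
      unfolding V_def v_def gradient_avg[OF \<theta>] gradient_avg[OF sn]
      by (simp add: X_def[abs_def] sum_subtractf scaleR_diff_right algebra_simps)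
    then have descent: "avg f n y \<le> avg f n \<theta> - (norm (gm \<theta>))\<^sup>2 / (6 * L) - L * (norm (y - \<theta>))\<^sup>2 + V I / (6 * L) + \<eta>"
      using condg_descent[OF \<theta> y_def] by simp
    have "(norm (y - sn))\<^sup>2 \<le> (1 + 1 / (2 * real m)) * r + (1 + 2 * real m) * (norm (y - \<theta>))\<^sup>2"
      using norm_add_power2_le[of "1 / (2 * real m)" "\<theta> - sn" "y - \<theta>"] m' by (simp add: r_def)
    then have "c * (norm (y - sn))\<^sup>2 \<le> c * ((1 + 1 / (2 * real m)) * r + (1 + 2 * real m) * (norm (y - \<theta>))\<^sup>2)"
      using c by (intro mult_left_mono)
    also have "\<dots> = c * (1 + 1 / (2 * real m)) * r + c * (1 + 2 * real m) * (norm (y - \<theta>))\<^sup>2"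
      by (subst distrib_left) (simp only: mult.assoc)
    also have "\<dots> \<le> c * (1 + 1 / (2 * real m)) * r + L * (norm (y - \<theta>))\<^sup>2"
      using c_le by (intro add_left_mono mult_right_mono) auto
    finally have "c * (norm (y - sn))\<^sup>2 \<le> c * (1 + 1 / (2 * real m)) * r + L * (norm (y - \<theta>))\<^sup>2" .
    moreover have "potential sn (Suc t) (vr_step \<Omega> lo f b lam \<eta> sn (gradient (avg f n) sn) I (\<theta>, visited, ic, lc))
        = avg f n y + c * (norm (y - sn))\<^sup>2 + W + (norm (gm \<theta>))\<^sup>2 / (6 * L)"
      unfolding potential_def vr_step_def Let_def prod.case v_def[symmetric] y_def[symmetric] W_def c_def k_def
      by (simp add: add_divide_distrib)
    ultimately show ?thesis
      using descent by linarith
  qed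
  have "measure_pmf.expectation ?R
      (\<lambda>I. potential sn (Suc t) (vr_step \<Omega> lo f b lam \<eta> sn (gradient (avg f n) sn) I (\<theta>, visited, ic, lc)))
    \<le> measure_pmf.expectation ?R (\<lambda>I. V I / (6 * L) + (avg f n \<theta> + \<eta> + c * (1 + 1 / (2 * real m)) * r + W))"
    by (intro expectation_mono_finite finite_set_pmf_indices pointwise)
  also have "\<dots> = measure_pmf.expectation ?R V / (6 * L) + (avg f n \<theta> + \<eta> + c * (1 + 1 / (2 * real m)) * r + W)"
    by (simp add: integrable_measure_pmf_finite[OF finite_set_pmf_indices] del: One_nat_def)
  \<comment> \<open>Smoothness of each \<open>f i\<close> bounds every \<open>X i\<close> by L times
    the distance to the snapshot.\<close>
  also have "measure_pmf.expectation ?R V / (6 * L) \<le> L / (6 * real b) * r"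
  proof -
    have "measure_pmf.expectation ?R V \<le> (L * norm (\<theta> - sn))\<^sup>2 / real b"
      using minibatch_variance[of "{1..n}" b X "L * norm (\<theta> - sn)"] b_pos n smooth \<theta> sn
      by (simp add: V_def[abs_def] X_def[abs_def] L_smooth_on_def)
    then have "measure_pmf.expectation ?R V / (6 * L) \<le> (L * norm (\<theta> - sn))\<^sup>2 / real b / (6 * L)"
      using L by (intro divide_right_mono) auto
    also have "\<dots> = L / (6 * real b) * r"
      using L by (simp add: r_def power_mult_distrib power2_eq_square mult_ac)
    finally show ?thesis .
  qed
  also have "L / (6 * real b) * r + (avg f n \<theta> + \<eta> + c * (1 + 1 / (2 * real m)) * r + W)
      = avg f n \<theta> + \<eta> + W + (c * (1 + 1 / (2 * real m)) + L / (6 * real b)) * r"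
    by (simp only: distrib_right)
  also have "\<dots> \<le> avg f n \<theta> + \<eta> + W + L * (real m - real t) / (3 * real b) * r"
    by (intro add_left_mono mult_right_mono c_step) (simp add: r_def)
  also have "\<dots> = potential sn t (\<theta>, visited, ic, lc) + \<eta>"
    by (simp add: potential_def r_def W_def)
  finally show ?thesis by simp
qed

lemma potential_vr_inner:
  assumes inv: "run_inv k j st" and sn: "sn \<in> \<Omega>"
  shows "t \<le> m \<Longrightarrow> measure_pmf.expectation
      (vr_inner \<Omega> lo f n b (\<lambda>_. lam) (\<lambda>_. \<eta>) sn (gradient (avg f n) sn) t st) (potential sn t)
    \<le> potential sn 0 st + real t * \<eta>"
proof (induction t)
  case (Suc t)
  let ?I = "vr_inner \<Omega> lo f n b (\<lambda>_. lam) (\<lambda>_. \<eta>) sn (gradient (avg f n) sn) t st"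
  let ?R = "replicate_pmf b (pmf_of_set {1..n})"
  let ?step = "vr_step \<Omega> lo f b lam \<eta> sn (gradient (avg f n) sn)"
  have "measure_pmf.expectation
      (vr_inner \<Omega> lo f n b (\<lambda>_. lam) (\<lambda>_. \<eta>) sn (gradient (avg f n) sn) (Suc t) st) (potential sn (Suc t))
    = measure_pmf.expectation ?I
        (\<lambda>st'. measure_pmf.expectation ?R (\<lambda>I. potential sn (Suc t) (?step I st')))"
    by (simp add: expectation_bind_finite finite_set_pmf_vr_inner finite_set_pmf_indices del: One_nat_def)
  also have "\<dots> \<le> measure_pmf.expectation ?I (\<lambda>st'. potential sn t st' + \<eta>)"
  proof (intro expectation_mono_finite finite_set_pmf_vr_inner)
    fix st' assume "st' \<in> set_pmf ?I"
    then have "run_inv (k + t) (j + t * (2 * b)) st'"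
      by (rule run_inv_vr_inner[OF inv])
    then obtain \<theta> visited ic lc where "st' = (\<theta>, visited, ic, lc)" "\<theta> \<in> \<Omega>"
      by (auto simp: run_inv_def)
    then show "measure_pmf.expectation ?R (\<lambda>I. potential sn (Suc t) (?step I st')) \<le> potential sn t st' + \<eta>"
      using potential_vr_step[OF _ sn, of \<theta> t] Suc.prems by simp
  qed
  also have "\<dots> = measure_pmf.expectation ?I (potential sn t) + \<eta>"
    by (simp add: integrable_measure_pmf_finite[OF finite_set_pmf_vr_inner])
  also have "\<dots> \<le> potential sn 0 st + real (Suc t) * \<eta>"
    using Suc by (simp add: algebra_simps)
  finally show ?case .
qed simp

text \<open>At \<open>t = m\<close> the weight of the distance to the snapshot vanishes, so \<open>potential x m\<close> does not
  depend on \<open>x\<close>.\<close>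

lemma potential_vr_epochs:
  assumes \<theta>\<^sub>0: "\<theta>\<^sub>0 \<in> \<Omega>"
  shows "measure_pmf.expectation (vr_epochs \<Omega> lo f n m b (\<lambda>_. lam) (\<lambda>_. \<eta>) \<theta>\<^sub>0 s) (potential \<theta>\<^sub>0 m)
    \<le> avg f n \<theta>\<^sub>0 + real (s * m) * \<eta>"
proof (induction s)
  case 0
  show ?case by (simp add: potential_def)
next
  case (Suc s)
  let ?E = "vr_epochs \<Omega> lo f n m b (\<lambda>_. lam) (\<lambda>_. \<eta>) \<theta>\<^sub>0 s"
  let ?e = "vr_epoch \<Omega> lo f n m b (\<lambda>_. lam) (\<lambda>_. \<eta>)"
  have fin: "finite (set_pmf (?e st))" for st
    by (auto simp: vr_epoch_def finite_set_pmf_vr_inner split: prod.splits)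
  have "measure_pmf.expectation (vr_epochs \<Omega> lo f n m b (\<lambda>_. lam) (\<lambda>_. \<eta>) \<theta>\<^sub>0 (Suc s)) (potential \<theta>\<^sub>0 m)
    = measure_pmf.expectation ?E (\<lambda>st. measure_pmf.expectation (?e st) (potential \<theta>\<^sub>0 m))"
    by (simp add: expectation_bind_finite finite_set_pmf_vr_epochs fin)
  also have "\<dots> \<le> measure_pmf.expectation ?E (\<lambda>st. potential \<theta>\<^sub>0 m st + real m * \<eta>)"
  proof (intro expectation_mono_finite finite_set_pmf_vr_epochs)
    fix st assume "st \<in> set_pmf ?E"
    then have inv: "run_inv (s * m) (s * (n + m * (2 * b))) st"
      by (rule run_inv_vr_epochs[OF \<theta>\<^sub>0])
    obtain \<theta> visited ic lc where st: "st = (\<theta>, visited, ic, lc)" by (cases st)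
    with inv have \<theta>: "\<theta> \<in> \<Omega>" and "run_inv (s * m) (ic + n) (\<theta>, visited, ic + n, lc)"
      by (auto simp: run_inv_def)
    \<comment> \<open>An epoch starts with the snapshot at the current point, so the distance term
      is zero at \<open>t = 0\<close> too: changing the snapshot costs nothing.\<close>
    from potential_vr_inner[OF this(2) \<theta> order.refl]
    show "measure_pmf.expectation (?e st) (potential \<theta>\<^sub>0 m) \<le> potential \<theta>\<^sub>0 m st + real m * \<eta>"
      by (simp add: st vr_epoch_def gradient_avg[OF \<theta>] potential_def[abs_def])
  qed
  also have "\<dots> = measure_pmf.expectation ?E (potential \<theta>\<^sub>0 m) + real m * \<eta>"
    by (simp add: integrable_measure_pmf_finite[OF finite_set_pmf_vr_epochs])
  also have "\<dots> \<le> avg f n \<theta>\<^sub>0 + real (Suc s * m) * \<eta>"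
    using Suc by (simp add: algebra_simps)
  finally show ?case .
qed

section \<open>Accuracy of the output and total cost\<close>

text \<open>A real infimum is a lower bound only for sets bounded below; compactness and continuity
  provide this.\<close>

lemma Inf_avg_le: "x \<in> \<Omega> \<Longrightarrow> (INF \<theta>\<in>\<Omega>. avg f n \<theta>) \<le> avg f n x"
proof (intro cINF_lower)
  have "continuous_on \<Omega> (avg f n)"
    using smooth_avg
    by (auto simp: L_smooth_on_def intro!: continuous_at_imp_continuous_on differentiable_imp_continuous_within)
  then show "bdd_below (avg f n ` \<Omega>)"
    using compact by (intro bounded_imp_bdd_below compact_imp_bounded compact_continuous_image)
qed

lemma ncgs_vr_expectation:
  assumes \<theta>\<^sub>0: "\<theta>\<^sub>0 \<in> \<Omega>" and T: "T > 0" "m dvd T"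
  shows "measure_pmf.expectation (ncgs_vr \<Omega> lo f n m b (\<lambda>_. lam) (\<lambda>_. \<eta>) T \<theta>\<^sub>0)
      (\<lambda>(\<theta>, _, _). (norm (gm \<theta>))\<^sup>2)
    \<le> 6 * L * (avg f n \<theta>\<^sub>0 - (INF \<theta>\<in>\<Omega>. avg f n \<theta>) + real T * \<eta>) / real T"
proof -
  let ?E = "vr_epochs \<Omega> lo f n m b (\<lambda>_. lam) (\<lambda>_. \<eta>) \<theta>\<^sub>0 (T div m)"
  let ?inf = "INF \<theta>\<in>\<Omega>. avg f n \<theta>"
  define out where "out st = (case st of (\<theta>, visited, ifo_calls, lo_calls) \<Rightarrow>
      do { \<alpha> \<leftarrow> pmf_of_set {..<length visited}; return_pmf (visited ! \<alpha>, ifo_calls, lo_calls) })"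
    for st :: "'a run_state"
  have Tm: "T div m * m = T" using T by simp
  have inv: "run_inv T (T div m * (n + m * (2 * b))) st" if "st \<in> set_pmf ?E" for st
    using run_inv_vr_epochs[OF \<theta>\<^sub>0 that] Tm by simp
  have fin: "finite (set_pmf (out st))" if "st \<in> set_pmf ?E" for st
    using inv[OF that] T by (cases st) (simp add: out_def run_inv_def lessThan_empty_iff)
  have "measure_pmf.expectation (ncgs_vr \<Omega> lo f n m b (\<lambda>_. lam) (\<lambda>_. \<eta>) T \<theta>\<^sub>0) (\<lambda>(\<theta>, _, _). (norm (gm \<theta>))\<^sup>2)
      = measure_pmf.expectation ?E (\<lambda>st. measure_pmf.expectation (out st) (\<lambda>(\<theta>, _, _). (norm (gm \<theta>))\<^sup>2))"
    unfolding ncgs_vr_def out_def[symmetric, abs_def]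
    by (rule expectation_bind_finite[OF finite_set_pmf_vr_epochs fin])
  also have "\<dots> \<le> measure_pmf.expectation ?E (\<lambda>st. 6 * L / real T * (potential \<theta>\<^sub>0 m st - ?inf))"
  proof (rule expectation_mono_finite[OF finite_set_pmf_vr_epochs])
    fix st assume st_in: "st \<in> set_pmf ?E"
    obtain \<theta> visited ic lc where st: "st = (\<theta>, visited, ic, lc)" by (cases st)
    have \<theta>: "\<theta> \<in> \<Omega>" and len: "length visited = T"
      using inv[OF st_in] by (auto simp: st run_inv_def)
    have out: "measure_pmf.expectation (out st) (\<lambda>(\<theta>, _, _). (norm (gm \<theta>))\<^sup>2)
        = (\<Sum>\<alpha><T. (norm (gm (visited ! \<alpha>)))\<^sup>2) / real T"
      using T by (simp add: st out_def len expectation_bind_finite integral_pmf_of_set lessThan_empty_iff)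
    have "(\<Sum>\<alpha><T. (norm (gm (visited ! \<alpha>)))\<^sup>2) = (\<Sum>x\<leftarrow>visited. (norm (gm x))\<^sup>2)"
      by (simp add: sum_list_sum_nth len atLeast0LessThan)
    \<comment> \<open>With \<open>t = m\<close> the distance term drops out, and the potential is
      the objective at the final point plus the booked sum.\<close>
    also have "\<dots> = 6 * L * (potential \<theta>\<^sub>0 m st - avg f n \<theta>)"
      using L by (simp add: st potential_def)
    also have "\<dots> \<le> 6 * L * (potential \<theta>\<^sub>0 m st - ?inf)"
      using Inf_avg_le[OF \<theta>] L by (intro mult_left_mono) auto
    finally show "measure_pmf.expectation (out st) (\<lambda>(\<theta>, _, _). (norm (gm \<theta>))\<^sup>2)
        \<le> 6 * L / real T * (potential \<theta>\<^sub>0 m st - ?inf)"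
      unfolding out by (simp add: divide_right_mono)
  qed
  also have "\<dots> = 6 * L / real T * (measure_pmf.expectation ?E (potential \<theta>\<^sub>0 m) - ?inf)"
    by (simp add: integrable_measure_pmf_finite[OF finite_set_pmf_vr_epochs])
  also have "\<dots> \<le> 6 * L / real T * (avg f n \<theta>\<^sub>0 + real T * \<eta> - ?inf)"
    using potential_vr_epochs[OF \<theta>\<^sub>0, of "T div m"] L unfolding Tm by (intro mult_left_mono) auto
  finally show ?thesis
    by (simp only: times_divide_eq_left diff_add_eq)
qed

lemma ncgs_vr_calls:
  assumes \<theta>\<^sub>0: "\<theta>\<^sub>0 \<in> \<Omega>" and T: "T > 0" "m dvd T"
    and run: "(\<theta>, ifo_calls, lo_calls) \<in> set_pmf (ncgs_vr \<Omega> lo f n m b (\<lambda>_. lam) (\<lambda>_. \<eta>) T \<theta>\<^sub>0)"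
  shows "ifo_calls = T div m * (n + m * (2 * b))" and "lo_calls \<le> enat (T * (2 * N + 1))"
proof -
  from run obtain \<theta>' visited where
    "(\<theta>', visited, ifo_calls, lo_calls) \<in> set_pmf (vr_epochs \<Omega> lo f n m b (\<lambda>_. lam) (\<lambda>_. \<eta>) \<theta>\<^sub>0 (T div m))"
    by (fastforce simp: ncgs_vr_def split: prod.splits)
  from run_inv_vr_epochs[OF \<theta>\<^sub>0 this] T
  show "ifo_calls = T div m * (n + m * (2 * b))" "lo_calls \<le> enat (T * (2 * N + 1))"
    by (auto simp: run_inv_def)
qed

end

section \<open>Choice of parameters and complexity\<close>

text \<open>Rounding a real number that is at least 1 changes it by a factor of at most 2; this
  holds here downwards and for the batch size upwards.\<close>

lemma epoch_length_bounds:
  assumes "n \<ge> 1"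
  shows "epoch_length n \<ge> 1" "real (epoch_length n) \<le> real n powr (1/3)"
    "real n powr (1/3) \<le> 2 * real (epoch_length n)"
proof -
  have "1 \<le> real n powr (1/3)"
    using assms by (simp add: ge_one_powr_ge_zero)
  then have "1 \<le> \<lfloor>real n powr (1/3)\<rfloor>"
    by simp
  then show "epoch_length n \<ge> 1" "real (epoch_length n) \<le> real n powr (1/3)"
    "real n powr (1/3) \<le> 2 * real (epoch_length n)"
    unfolding epoch_length_def by linarith+
qed

lemma batch_size_bounds:
  assumes "n \<ge> 1"
  shows "(epoch_length n)\<^sup>2 \<le> batch_size n" "real (batch_size n) \<le> 2 * real n powr (2/3)"
proof -
  have 1: "1 \<le> real n powr (2/3)"
    using assms by (simp add: ge_one_powr_ge_zero)
  then show "real (batch_size n) \<le> 2 * real n powr (2/3)"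
    unfolding batch_size_def by linarith
  have "(real (epoch_length n))\<^sup>2 \<le> (real n powr (1/3))\<^sup>2"
    using epoch_length_bounds[OF assms] by (intro power_mono) auto
  also have "\<dots> = real n powr (2/3)"
    by (simp add: power2_eq_square flip: powr_add)
  also have "\<dots> \<le> real (batch_size n)"
    unfolding batch_size_def by linarith
  finally show "(epoch_length n)\<^sup>2 \<le> batch_size n"
    by (simp flip: of_nat_power)
qed

theorem corollary3:
  fixes L \<Delta> D K :: real
  assumes "L > 0"
  shows "\<exists>C>0. \<forall>n\<ge>1. \<forall>\<epsilon>>0. \<exists>T>0. epoch_length n dvd T \<and>
    (\<forall>(\<Omega> :: 'a::euclidean_space set) lo (f :: nat \<Rightarrow> 'a \<Rightarrow> real) \<theta>\<^sub>0.
       compact \<Omega> \<and> convex \<Omega> \<and> diameter \<Omega> \<le> D \<and> linear_oracle \<Omega> lo \<and>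
       (\<forall>i\<in>{1..n}. L_smooth_on \<Omega> L (f i)) \<and>
       \<theta>\<^sub>0 \<in> \<Omega> \<and> avg f n \<theta>\<^sub>0 - (INF \<theta>\<in>\<Omega>. avg f n \<theta>) \<le> \<Delta> \<longrightarrow>
       (let lam = 1 / (3 * L);
            run = ncgs_vr \<Omega> lo f n (epoch_length n) (batch_size n)
                    (\<lambda>_. lam) (\<lambda>_. 1 / real T) T \<theta>\<^sub>0
        in measure_pmf.expectation run
             (\<lambda>(\<theta>, _, _). (norm (grad_mapping \<Omega> \<theta> (gradient (avg f n) \<theta>) lam))\<^sup>2) \<le> \<epsilon> \<and>
           (real n powr (1/3) * \<epsilon> \<le> K \<longrightarrow>
             (\<forall>(\<theta>, ifo_calls, lo_calls) \<in> set_pmf run.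
                real ifo_calls \<le> C * (real n powr (2/3) / \<epsilon>) \<and>
                ereal_of_enat lo_calls \<le> ereal (C * (1 / \<epsilon>\<^sup>2))))))"
proof -
  define M where "M = D\<^sup>2 / (1 / (3 * L))"
  \<comment> \<open>The numerator of the accuracy bound when T \<eta> = 1; the absolute value keeps
    it positive for every \<Delta>.\<close>
  define c0 where "c0 = 6 * L * (\<bar>\<Delta>\<bar> + 1)"
  \<comment> \<open>T is at most A/\<epsilon>: \<open>c0\<close> from the accuracy, \<bar>K\<bar>
    from rounding to whole epochs.\<close>
  define A where "A = c0 + \<bar>K\<bar>"
  \<comment> \<open>IFO: an epoch costs at most (2 + 4) m n^(2/3), with 2 from n \<le> 2 m n^(2/3)
    and 4 from two calls per index and b \<le> 2 n^(2/3). LO: T (2 N + 1) with N \<le> 2 M T + 2 and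
    T \<ge> 1.\<close>
  define C where "C = max (6 * A) ((4 * M + 5) * A\<^sup>2)"
  have M: "M \<ge> 0" and c0: "c0 > 0"
    using \<open>L > 0\<close> by (auto simp: M_def c0_def intro: add_nonneg_pos)
  have A: "A > 0" using c0 by (simp add: A_def)
  have C: "C > 0" using A by (simp add: C_def less_max_iff_disj)
  show ?thesis
  proof (rule exI[of _ C], intro conjI C allI impI)
    fix n :: nat and \<epsilon> :: real assume n: "n \<ge> 1" and \<epsilon>: "\<epsilon> > 0"
    define m b where "m = epoch_length n" and "b = batch_size n"
    note m = epoch_length_bounds[OF n, folded m_def] and b = batch_size_bounds[OF n, folded m_def b_def]
    \<comment> \<open>The number of epochs, the least that brings T = m S up to
      c0/\<epsilon>.\<close>
    define S where "S = nat \<lceil>c0 / (\<epsilon> * real m)\<rceil>"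
    define T where "T = m * S"
    have "c0 / (\<epsilon> * real m) > 0"
      using c0 \<epsilon> m by simp
    then have S: "S > 0" "c0 / (\<epsilon> * real m) \<le> real S" "real S \<le> c0 / (\<epsilon> * real m) + 1"
      unfolding S_def by linarith+
    have T: "T > 0" "m dvd T" "T div m = S"
      using S(1) m(1) by (auto simp: T_def)
    have T_ge: "c0 / \<epsilon> \<le> real T"
      using mult_left_mono[OF S(2), of "real m"] m(1) by (simp add: T_def)
    have T_le: "real T \<le> A / \<epsilon>" if K: "real n powr (1/3) * \<epsilon> \<le> K"
    proof -
      have "real T \<le> c0 / \<epsilon> + real m"
        using mult_left_mono[OF S(3), of "real m"] m(1) by (simp add: T_def distrib_left)
      also have "real m \<le> \<bar>K\<bar> / \<epsilon>"
        using m(2) K \<epsilon> by (smt (verit) mult_right_mono pos_le_divide_eq)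
      finally show ?thesis
        by (simp add: A_def add_divide_distrib)
    qed
    \<comment> \<open>Since \<eta> = 1/T, the locale asks for 2 M T \<le> N; the added 1 covers
      \<open>M = 0\<close>.\<close>
    define N where "N = nat \<lceil>2 * M * real T\<rceil> + 1"
    have N: "N \<ge> 1" "2 * M * real T \<le> real N" "real N \<le> 2 * M * real T + 2"
    proof -
      have "0 \<le> 2 * M * real T" using M by simp
      then show "N \<ge> 1" "2 * M * real T \<le> real N" "real N \<le> 2 * M * real T + 2"
        unfolding N_def by linarith+
    qed
    have ifo: "real (S * (n + m * (2 * b))) \<le> 6 * A * (real n powr (2/3) / \<epsilon>)"
      if K: "real n powr (1/3) * \<epsilon> \<le> K"
    proof -
      have "real n = real n powr (1/3) * real n powr (2/3)"
        using n by (simp flip: powr_add)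
      also have "\<dots> \<le> (2 * real m) * real n powr (2/3)"
        using m(3) by (intro mult_right_mono) auto
      finally have "real n + real m * (2 * real b) \<le> (2 * real m) * real n powr (2/3) + real m * (2 * (2 * real n powr (2/3)))"
        using b(2) by (intro add_mono mult_left_mono) auto
      then have "real S * (real n + real m * (2 * real b)) \<le> real S * (6 * real m * real n powr (2/3))"
        by (intro mult_left_mono) auto
      also have "\<dots> = 6 * real n powr (2/3) * real T"
        by (simp add: T_def)
      also have "\<dots> \<le> 6 * real n powr (2/3) * (A / \<epsilon>)"
        using T_le[OF K] by (intro mult_left_mono) auto
      finally show ?thesis by (simp add: mult_ac)
    qed
    have lo_bound: "real (T * (2 * N + 1)) \<le> (4 * M + 5) * A\<^sup>2 * (1 / \<epsilon>\<^sup>2)"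
      if K: "real n powr (1/3) * \<epsilon> \<le> K"
    proof -
      have "1 \<le> real T" using T(1) by simp
      then have "2 * real N + 1 \<le> (4 * M + 5) * real T"
        using N(3) by (simp add: distrib_right)
      then have "real T * (2 * real N + 1) \<le> real T * ((4 * M + 5) * real T)"
        by (intro mult_left_mono) auto
      also have "\<dots> = (4 * M + 5) * (real T)\<^sup>2"
        by (simp add: power2_eq_square)
      also have "\<dots> \<le> (4 * M + 5) * (A / \<epsilon>)\<^sup>2"
        using T_le[OF K] M by (intro mult_left_mono power_mono) auto
      finally show ?thesis by (simp add: power_divide distrib_left)
    qed
    show "\<exists>T>0. epoch_length n dvd T \<and>
    (\<forall>(\<Omega> :: 'a::euclidean_space set) lo (f :: nat \<Rightarrow> 'a \<Rightarrow> real) \<theta>\<^sub>0.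
       compact \<Omega> \<and> convex \<Omega> \<and> diameter \<Omega> \<le> D \<and> linear_oracle \<Omega> lo \<and>
       (\<forall>i\<in>{1..n}. L_smooth_on \<Omega> L (f i)) \<and>
       \<theta>\<^sub>0 \<in> \<Omega> \<and> avg f n \<theta>\<^sub>0 - (INF \<theta>\<in>\<Omega>. avg f n \<theta>) \<le> \<Delta> \<longrightarrow>
       (let lam = 1 / (3 * L);
            run = ncgs_vr \<Omega> lo f n (epoch_length n) (batch_size n)
                    (\<lambda>_. lam) (\<lambda>_. 1 / real T) T \<theta>\<^sub>0
        in measure_pmf.expectation run
             (\<lambda>(\<theta>, _, _). (norm (grad_mapping \<Omega> \<theta> (gradient (avg f n) \<theta>) lam))\<^sup>2) \<le> \<epsilon> \<and>
           (real n powr (1/3) * \<epsilon> \<le> K \<longrightarrow>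
             (\<forall>(\<theta>, ifo_calls, lo_calls) \<in> set_pmf run.
                real ifo_calls \<le> C * (real n powr (2/3) / \<epsilon>) \<and>
                ereal_of_enat lo_calls \<le> ereal (C * (1 / \<epsilon>\<^sup>2))))))"
      unfolding Let_def m_def[symmetric] b_def[symmetric]
    proof (intro exI[of _ T] conjI T(1) T(2) allI impI; (elim conjE)?)
      fix \<Omega> :: "'a set" and lo and f :: "nat \<Rightarrow> 'a \<Rightarrow> real" and \<theta>\<^sub>0
      assume hyps: "compact \<Omega>" "convex \<Omega>" "diameter \<Omega> \<le> D" "linear_oracle \<Omega> lo"
        "\<forall>i\<in>{1..n}. L_smooth_on \<Omega> L (f i)"
        and \<theta>\<^sub>0: "\<theta>\<^sub>0 \<in> \<Omega>" and \<Delta>: "avg f n \<theta>\<^sub>0 - (INF \<theta>\<in>\<Omega>. avg f n \<theta>) \<le> \<Delta>"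
      interpret ncgs_vr_setting \<Omega> lo f L D "1 / real T" n m b N
        by unfold_locales
          (use hyps \<open>L > 0\<close> n m(1) b(1) N T(1) in \<open>auto simp: M_def field_simps\<close>)
      have "6 * L * (avg f n \<theta>\<^sub>0 - (INF \<theta>\<in>\<Omega>. avg f n \<theta>) + 1) \<le> c0"
        unfolding c0_def using \<Delta> \<open>L > 0\<close> by (intro mult_left_mono) auto
      also have "c0 \<le> \<epsilon> * real T"
        using T_ge \<epsilon> by (simp add: field_simps)
      finally show "measure_pmf.expectation (ncgs_vr \<Omega> lo f n m b (\<lambda>_. 1 / (3 * L)) (\<lambda>_. 1 / real T) T \<theta>\<^sub>0)
          (\<lambda>(\<theta>, _, _). (norm (grad_mapping \<Omega> \<theta> (gradient (avg f n) \<theta>) (1 / (3 * L))))\<^sup>2) \<le> \<epsilon>"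
        using ncgs_vr_expectation[OF \<theta>\<^sub>0 T(1,2)] T(1)
        by (elim order_trans) (simp add: divide_le_eq)
      assume K: "real n powr (1/3) * \<epsilon> \<le> K"
      have "real ic \<le> C * (real n powr (2/3) / \<epsilon>) \<and> ereal_of_enat lc \<le> ereal (C * (1 / \<epsilon>\<^sup>2))"
        if run: "(\<theta>, ic, lc) \<in> set_pmf (ncgs_vr \<Omega> lo f n m b (\<lambda>_. 1 / (3 * L)) (\<lambda>_. 1 / real T) T \<theta>\<^sub>0)" for \<theta> ic lc
      proof
        note calls = ncgs_vr_calls[OF \<theta>\<^sub>0 T(1,2) run]
        have "real ic \<le> 6 * A * (real n powr (2/3) / \<epsilon>)"
          using ifo[OF K] by (simp only: calls(1) T(3))
        also have "\<dots> \<le> C * (real n powr (2/3) / \<epsilon>)"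
          using \<epsilon> by (intro mult_right_mono) (auto simp: C_def)
        finally show "real ic \<le> C * (real n powr (2/3) / \<epsilon>)" .
        have "ereal_of_enat lc \<le> ereal (real (T * (2 * N + 1)))"
          using calls(2) by (metis ereal_of_enat_le_iff ereal_of_enat_simps(1))
        also have "real (T * (2 * N + 1)) \<le> (4 * M + 5) * A\<^sup>2 * (1 / \<epsilon>\<^sup>2)"
          by (rule lo_bound[OF K])
        also have "\<dots> \<le> C * (1 / \<epsilon>\<^sup>2)"
          by (intro mult_right_mono) (auto simp: C_def)
        finally show "ereal_of_enat lc \<le> ereal (C * (1 / \<epsilon>\<^sup>2))" by simp
      qed
      then show "\<forall>(\<theta>, ifo_calls, lo_calls) \<in> set_pmf (ncgs_vr \<Omega> lo f n m b (\<lambda>_. 1 / (3 * L)) (\<lambda>_. 1 / real T) T \<theta>\<^sub>0).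
          real ifo_calls \<le> C * (real n powr (2/3) / \<epsilon>) \<and> ereal_of_enat lo_calls \<le> ereal (C * (1 / \<epsilon>\<^sup>2))"
        by auto
    qed
  qed
qed

end
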